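(* Let $0<a<b<\pi$ and let $p,q\in L_2(0,\pi)$ be complex-valued. For each $j\in\{0,1\}$, the spectrum $\{\lambda_{nj}\}_{n\ge1}$ of the boundary value problem ${\mathcal L}_j(p,q)$ satisfies the asymptotic formula $$\lambda_{nj}=\Big(n-\frac j2\Big)^2+\varkappa_{nj},\qquad n\ge 1,\qquad \{\varkappa_{nj}\}_{n\ge1}\in\ell_2 .$$
   Context: For $j\in\{0,1\}$, ${\mathcal L}_j(p,q)$ is the boundary value problem with two frozen arguments $a,b$ (where $0<a<b<\pi$) $$-y''(x)+p(x)y(a)+q(x)y(b)=\lambda y(x),\quad x\in(0,\pi),\qquad y^{(j)}(0)=y(\pi)=0,$$ with spectral parameter $\lambda\in\mathbb C$; here $y^{(0)}=y$, $y^{(1)}=y'$. Its spectrum $\{\lambda_{nj}\}_{n\ge1}$ is the sequence of its eigenvalues, i.e. of the zeros, counted with multiplicity and numbered so that $|\lambda_{1j}|\le|\lambda_{2j}|\le\cdots$, of the characteristic function, which is the entire function of $\lambda=\rho^2$ $$\Delta_j(\lambda)=\left|\begin{array}{ccc} \varphi_j(\rho,\pi) & \int_0^\pi \frac{\sin\rho(\pi-t)}{\rho}p(t)\,dt & \int_0^\pi \frac{\sin\rho(\pi-t)}{\rho}q(t)\,dt\\ \varphi_j(\rho,a) & \int_0^a \frac{\sin\rho(a-t)}{\rho}p(t)\,dt-1 & \int_0^a \frac{\sin\rho(a-t)}{\rho}q(t)\,dt\\ \varphi_j(\rho,b) & \int_0^b \frac{\sin\rho(b-t)}{\rho}p(t)\,dt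 & \int_0^b \frac{\sin\rho(b-t)}{\rho}q(t)\,dt-1 \end{array}\right|,$$ where $\varphi_0(\rho,z)=\rho^{-1}\sin\rho z$ and $\varphi_1(\rho,z)=\cos\rho z$ (values at $\rho=0$ are understood by continuity). *)

theory Defs
  imports "HOL-Complex_Analysis.Complex_Analysis"
begin

definition L2_pi :: "(real \<Rightarrow> complex) \<Rightarrow> bool" where
  "L2_pi f \<longleftrightarrow>
     f \<in> borel_measurable (lebesgue_on {0<..<pi}) \<and>
     integrable (lebesgue_on {0<..<pi}) (\<lambda>t. (cmod (f t))\<^sup>2)"

(* sin (rho x) / rho, extended by continuity to rho = 0 *)
definition sin_quot :: "complex \<Rightarrow> real \<Rightarrow> complex" where
  "sin_quot \<rho> x = (if \<rho> = 0 then of_real x else sin (\<rho> * of_real x) / \<rho>)"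

(* Only j = 0 (Dirichlet condition at 0) and j = 1 (Neumann condition at 0) are meaningful. *)
definition phi :: "nat \<Rightarrow> complex \<Rightarrow> real \<Rightarrow> complex" where
  "phi j \<rho> x = (if j = 0 then sin_quot \<rho> x else cos (\<rho> * of_real x))"

definition sin_conv :: "(real \<Rightarrow> complex) \<Rightarrow> complex \<Rightarrow> real \<Rightarrow> complex" where
  "sin_conv f \<rho> x = (LINT t:{0<..<x}|lebesgue. sin_quot \<rho> (x - t) * f t)"

definition char_matrix ::
  "real \<Rightarrow> real \<Rightarrow> (real \<Rightarrow> complex) \<Rightarrow> (real \<Rightarrow> complex) \<Rightarrow> nat \<Rightarrow> complex \<Rightarrow> complex ^ 3 ^ 3"
where
  "char_matrix a b p q j \<rho> = vector
     [vector [phi j \<rho> pi, sin_conv p \<rho> pi,    sin_conv q \<rho> pi],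
      vector [phi j \<rho> a,  sin_conv p \<rho> a - 1, sin_conv q \<rho> a],
      vector [phi j \<rho> b,  sin_conv p \<rho> b,     sin_conv q \<rho> b - 1]]"

(* The characteristic function of the problem
     - y''(x) + p(x) y(a) + q(x) y(b) = z y(x)  on (0, pi),   y^(j)(0) = y(pi) = 0.
   All matrix entries are even in rho, so the choice of the square root of z is immaterial. *)
definition char_fun ::
  "real \<Rightarrow> real \<Rightarrow> (real \<Rightarrow> complex) \<Rightarrow> (real \<Rightarrow> complex) \<Rightarrow> nat \<Rightarrow> complex \<Rightarrow> complex"
where
  "char_fun a b p q j z = det (char_matrix a b p q j (csqrt z))"

(* The family (ev n), n \<ge> 1, lists the zeros of the characteristic function, each exactly as often
   as its multiplicity, by nondecreasing modulus.  The value ev 0 plays no role. *)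
definition is_spectrum ::
  "real \<Rightarrow> real \<Rightarrow> (real \<Rightarrow> complex) \<Rightarrow> (real \<Rightarrow> complex) \<Rightarrow> nat \<Rightarrow> (nat \<Rightarrow> complex) \<Rightarrow> bool"
where
  "is_spectrum a b p q j ev \<longleftrightarrow>
     (\<forall>n\<ge>1. char_fun a b p q j (ev n) = 0) \<and>
     (\<forall>z. char_fun a b p q j z = 0 \<longrightarrow>
        finite {n. 1 \<le> n \<and> ev n = z} \<and>
        int (card {n. 1 \<le> n \<and> ev n = z}) = zorder (char_fun a b p q j) z) \<and>
     (\<forall>m n. 1 \<le> m \<and> m \<le> n \<longrightarrow> cmod (ev m) \<le> cmod (ev n))"

end

theory Submission
  imports Defs
begin

text \<open>
  Write \<open>z = \<rho>\<^sup>2\<close> with \<open>\<rho> = csqrt z\<close>. For \<open>p = q = 0\<close> the characteristic function is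
  \<open>phi j \<rho> pi\<close>, that is, \<open>sin (\<rho> pi) / \<rho>\<close> or \<open>cos (\<rho> pi)\<close>, with simple zeros at the squares of
  \<open>n - j/2\<close>. The theorem says that \<open>p\<close> and \<open>q\<close> perturb these zeros by a square-summable sequence.

  Expanded naively, the determinant contains products such as \<open>phi j \<rho> a * sin_conv p \<rho> pi\<close>, which
  grow like \<open>exp ((pi + a) \<bar>Im \<rho>\<bar>)\<close>, faster than the leading term. The cancellation becomes
  visible after pivoting on the entry \<open>phi j \<rho> pi\<close> (Chio condensation,
  \<open>det_char_matrix_condensed\<close>): the determinant times its pivot is a \<open>2 \<times> 2\<close> determinant
  whose entries involve only the minors
  \<open>osc j \<rho> x * sin_conv f \<rho> pi - osc j \<rho> pi * sin_conv f \<rho> x\<close>, with \<open>osc j \<rho> x\<close> the numerator of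
  \<open>phi j \<rho> x\<close>. Such a minor is, up to the factor \<open>\<rho>\<close>, the numerator of the Green function of the
  unperturbed problem integrated against \<open>f\<close>. An addition theorem collapses its kernel
  (\<open>osc_kernel_identity\<close>), so the minor is \<open>O(exp (pi \<bar>Im \<rho>\<bar>) / \<bar>\<rho>\<bar>)\<close> (\<open>norm_minor_le\<close>). No
  integral representation of the full determinant is needed after that: whenever
  \<open>\<bar>osc j \<rho> pi\<bar>\<close> exceeds three times the minors, the characteristic function is closer to
  \<open>phi j \<rho> pi\<close> than \<open>phi j \<rho> pi\<close> is to zero (\<open>det_char_matrix_near_phi\<close>).

  This one comparison is used in three ways.

  \<^item> On the circles \<open>\<bar>\<rho>\<bar> = N + 1/2 - j/2\<close> the sine is comparable to \<open>exp (pi \<bar>Im \<rho>\<bar>)\<close>, so by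
    Rouche's theorem exactly \<open>N\<close> zeros lie inside for every large \<open>N\<close> (\<open>sum_zorder_char_fun\<close>).
    Consequently the zeros can be listed by modulus, and in any such list the \<open>n\<close>-th one lies
    between two consecutive circles.
  \<^item> Read contrapositively, at a zero the sine is \<open>O(exp (pi \<bar>Im \<rho>\<bar>) / \<bar>\<rho>\<bar>)\<close>, which forces
    \<open>\<rho>\<^sub>n = n - j/2 + O(1/n)\<close> (\<open>zero_near_grid\<close>).
  \<^item> Read contrapositively once more, with the actual minors at \<open>\<rho>\<^sub>n\<close> in place of their bound: the
    remainder \<open>\<rho>\<^sub>n\<^sup>2 - (n - j/2)\<^sup>2\<close> is bounded by a constant times a sum of integrals
    \<open>\<integral> sin (\<rho>\<^sub>n (x - t)) f t dt\<close> over \<open>(0, x)\<close>. Replacing \<open>\<rho>\<^sub>n\<close> by \<open>n - j/2\<close> costs \<open>O(1/n)\<close>, and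
    what remains are coefficients of \<open>f\<close> in an orthogonal system, square-summable by Bessel's
    inequality (\<open>sin_conv_scaled_square_summable\<close>).
\<close>

section \<open>Sine and cosine off the real axis\<close>

lemma norm_sin_le_exp_Im: "cmod (sin z) \<le> exp \<bar>Im z\<bar>"
proof -
  have "cmod (exp (\<i> * z) - exp (- (\<i> * z))) \<le> exp (- Im z) + exp (Im z)"
    by (rule order_trans[OF norm_triangle_ineq4]) simp
  also have "\<dots> \<le> exp \<bar>Im z\<bar> + exp \<bar>Im z\<bar>"
    by (intro add_mono) auto
  finally show ?thesis
    by (simp add: sin_exp_eq norm_divide norm_mult)
qed

lemma norm_cos_le_exp_Im: "cmod (cos z) \<le> exp \<bar>Im z\<bar>"
  using norm_sin_le_exp_Im[of "of_real pi / 2 - z"] by (simp add: cos_sin_eq)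

text \<open>
  The mean value inequality on the convex strip \<open>\<bar>Im z\<bar> \<le> c\<close>, where the derivative is
  at most \<open>exp c\<close>.
\<close>
lemma norm_sin_diff_le:
  assumes "\<bar>Im z\<bar> \<le> c" "\<bar>Im w\<bar> \<le> c"
  shows "cmod (sin z - sin w) \<le> exp c * cmod (z - w)"
proof (rule field_differentiable_bound)
  show "convex {z. \<bar>Im z\<bar> \<le> c}"
    using convex_Int[OF convex_halfspace_Im_le[of c] convex_halfspace_Im_ge[of "-c"]]
    by (rule back_subst[where P = convex]) auto
  show "cmod (cos \<zeta>) \<le> exp c" if "\<zeta> \<in> {z. \<bar>Im z\<bar> \<le> c}" for \<zeta>
    using that norm_cos_le_exp_Im[of \<zeta>] by (auto intro: order_trans)
  show "(sin has_field_derivative cos \<zeta>) (at \<zeta> within {z. \<bar>Im z\<bar> \<le> c})" for \<zeta> :: complex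
    by (auto intro!: derivative_eq_intros)
qed (use assms in auto)

text \<open>
  Concavity of the sine on \<open>[0, pi/2]\<close> even gives \<open>2 * v\<close> on the left.
\<close>
lemma le_sin_pi_times:
  fixes v :: real assumes "0 \<le> v" "v \<le> 1/2"
  shows "v \<le> sin (pi * v)"
proof -
  have "concave_on {0..pi/2} sin"
    by (rule f''_le0_imp_concave[where f' = cos and f'' = "\<lambda>x. - sin x"])
       (auto intro!: derivative_eq_intros sin_ge_zero)
  from concave_onD[OF this, of "2 * v" 0 "pi / 2"] assms have "2 * v \<le> sin (pi * v)"
    by (simp add: mult.commute)
  with assms show ?thesis by linarith
qed

text \<open>
  From \<open>\<bar>sin z\<bar>\<^sup>2 = sin\<^sup>2 (Re z) cosh\<^sup>2 (Im z) + cos\<^sup>2 (Re z) sinh\<^sup>2 (Im z)\<close>, keeping the first summand.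
\<close>
lemma norm_sin_ge_Re: "\<bar>sin (Re z)\<bar> * exp \<bar>Im z\<bar> / 2 \<le> cmod (sin z)"
proof -
  have "(\<bar>sin (Re z)\<bar> * exp \<bar>Im z\<bar> / 2)\<^sup>2 \<le> (cmod (sin z))\<^sup>2"
  proof -
    let ?s = "sin (Re z)" and ?e = "exp \<bar>Im z\<bar>"
    have "?s\<^sup>2 * ?e\<^sup>2 / 4 \<le> ?s\<^sup>2 * ((?e + inverse ?e) / 2)\<^sup>2"
      by (simp add: power_divide mult_left_mono power_mono)
    also have "\<dots> \<le> ?s\<^sup>2 + ((?e - inverse ?e) / 2)\<^sup>2"
    proof -
      have "?s\<^sup>2 * ((?e + inverse ?e) / 2)\<^sup>2 = ?s\<^sup>2 + ?s\<^sup>2 * ((?e - inverse ?e) / 2)\<^sup>2"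
        by (simp add: power2_eq_square field_simps)
      also have "\<dots> \<le> ?s\<^sup>2 + ((?e - inverse ?e) / 2)\<^sup>2"
        using mult_right_mono[of "?s\<^sup>2" 1 "((?e - inverse ?e) / 2)\<^sup>2"]
        by (simp add: abs_square_le_1)
      finally show ?thesis .
    qed
    also have "\<dots> = (cmod (sin z))\<^sup>2"
      using norm_cos_squared[of "of_real pi / 2 - z"]
      by (cases "Im z \<ge> 0")
         (simp_all add: cos_diff power_divide exp_minus power2_commute)
    finally show ?thesis by (simp add: power_mult_distrib power_divide)
  qed
  then show ?thesis by (rule power2_le_imp_le) simp
qed

lemma norm_sin_ge_Im: "(exp \<bar>Im z\<bar> - exp (- \<bar>Im z\<bar>)) / 2 \<le> cmod (sin z)"
proof -
  have "cmod (exp (\<i> * z)) - cmod (exp (- (\<i> * z))) \<le> cmod (exp (\<i> * z) - exp (- (\<i> * z)))"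
    by (rule norm_triangle_ineq2)
  moreover have "cmod (exp (- (\<i> * z))) - cmod (exp (\<i> * z)) \<le> cmod (exp (\<i> * z) - exp (- (\<i> * z)))"
    by (subst norm_minus_commute) (rule norm_triangle_ineq2)
  ultimately show ?thesis
    by (cases "Im z \<ge> 0") (simp_all add: sin_exp_eq norm_divide norm_mult)
qed

text \<open>
  Up to the unavoidable factor \<open>exp (pi \<bar>Im w\<bar>)\<close>, the sine controls the distance of \<open>w\<close> to the
  nearest integer. The real part of \<open>w - m\<close> is controlled by \<open>norm_sin_ge_Re\<close>, the imaginary part by
  \<open>norm_sin_ge_Im\<close>; the truncation at 1 is needed because the quotient of the sine by the
  exponential is bounded.
\<close>
lemma norm_sin_pi_ge:
  fixes w :: complex and m :: int
  assumes "\<bar>Re w - m\<bar> \<le> 1/2"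
  shows "exp (pi * \<bar>Im w\<bar>) * min 1 (cmod (w - m)) / 8 \<le> cmod (sin (of_real pi * w))"
proof -
  define v where "v = Re w - m"
  define E where "E = exp (pi * \<bar>Im w\<bar>)"
  have E: "E > 0" by (simp add: E_def)
  have "\<bar>sin (pi * Re w)\<bar> = \<bar>sin (pi * v)\<bar>"
  proof -
    have "sin (pi * Re w) = sin (pi * v) * cos (pi * m)"
      using sin_add[of "pi * v" "pi * m"] by (simp add: v_def algebra_simps)
    moreover have "\<bar>cos (pi * m)\<bar> = 1"
      by (cases "even m") (auto simp: cos_npi_int mult.commute)
    ultimately show ?thesis by (simp add: abs_mult)
  qed
  also have "\<dots> \<ge> \<bar>v\<bar>"
    using le_sin_pi_times[of v] le_sin_pi_times[of "-v"] assms by (cases "v \<ge> 0") (auto simp flip: v_def)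
  finally have "\<bar>v\<bar> * E / 2 \<le> \<bar>sin (Re (of_real pi * w))\<bar> * exp \<bar>Im (of_real pi * w)\<bar> / 2"
    using E by (simp add: E_def abs_mult mult_right_mono)
  also have "\<dots> \<le> cmod (sin (of_real pi * w))" by (rule norm_sin_ge_Re)
  finally have 1: "\<bar>v\<bar> * E / 2 \<le> cmod (sin (of_real pi * w))" .
  \<comment> \<open>The imaginary part: \<open>1 - exp (-y)\<close> is at least \<open>y / (1 + y)\<close>, here with \<open>y = 2 h\<close>.\<close>
  define h where "h = min 1 \<bar>Im w\<bar>"
  have h: "0 \<le> h" "h \<le> 1" "h \<le> \<bar>Im w\<bar>" by (auto simp: h_def)
  have "exp (- (2 * pi * \<bar>Im w\<bar>)) \<le> exp (- (2 * h))"
    using mult_mono[of 2 "2 * pi" h "\<bar>Im w\<bar>"] h pi_gt3 by simp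
  also have "\<dots> = 1 / exp (2 * h)"
    by (simp add: exp_minus inverse_eq_divide)
  also have "\<dots> \<le> 1 / (1 + 2 * h)"
    using exp_ge_add_one_self[of "2 * h"] h by (intro divide_left_mono) auto
  also have "\<dots> \<le> 1 - h / 2"
    using h mult_left_mono[of h 1 h] by (simp add: field_simps)
  finally have "h / 2 \<le> 1 - exp (- (2 * pi * \<bar>Im w\<bar>))" by simp
  then have "E * (h / 2) \<le> E * (1 - exp (- (2 * pi * \<bar>Im w\<bar>)))"
    using E by (intro mult_left_mono) auto
  also have "\<dots> = E - exp (- (pi * \<bar>Im w\<bar>))"
    by (simp add: E_def algebra_simps flip: exp_add)
  finally have 2: "E * h / 4 \<le> cmod (sin (of_real pi * w))"
    using norm_sin_ge_Im[of "of_real pi * w"] by (simp add: E_def abs_mult)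
  have "cmod (w - m) \<le> \<bar>v\<bar> + \<bar>Im w\<bar>"
    using cmod_le[of "w - m"] by (simp add: v_def)
  then have "min 1 (cmod (w - m)) \<le> \<bar>v\<bar> + h"
    by (auto simp: h_def min_def)
  then have "E * min 1 (cmod (w - m)) / 8 \<le> E * (\<bar>v\<bar> + h) / 8"
    using E by (simp add: mult_left_mono)
  also have "\<dots> = \<bar>v\<bar> * E / 2 / 4 + E * h / 4 / 2"
    by (simp add: algebra_simps)
  also have "\<dots> \<le> cmod (sin (of_real pi * w))"
    using 1 2 norm_ge_zero[of "sin (of_real pi * w)"] by linarith
  finally show ?thesis by (simp add: E_def)
qed

section \<open>Condensing the characteristic determinant\<close>

text \<open>
  The numerator of \<open>phi\<close>: an entire function of exponential type \<open>x\<close> without the quotient by \<open>\<rho>\<close>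
  that \<open>phi\<close> has for \<open>j = 0\<close>.
\<close>
definition osc :: "nat \<Rightarrow> complex \<Rightarrow> real \<Rightarrow> complex" where
  "osc j \<rho> x = (if j = 0 then sin (\<rho> * of_real x) else cos (\<rho> * of_real x))"

lemma osc_eq_phi: "osc j \<rho> x = (if j = 0 then \<rho> else 1) * phi j \<rho> x"
  by (simp add: osc_def phi_def sin_quot_def)

text \<open>
  The shift by \<open>j/2\<close> lets both boundary conditions be treated through zeros of \<open>sin (pi w)\<close> at the
  integers.
\<close>
lemma osc_pi_eq_sin:
  "j \<in> {0, 1} \<Longrightarrow> osc j \<rho> pi = sin (of_real pi * (\<rho> + of_real (real j / 2)))"
  by (auto simp: osc_def sin_add distrib_left mult.commute)

lemma norm_osc_le: "0 \<le> x \<Longrightarrow> cmod (osc j \<rho> x) \<le> exp (\<bar>Im \<rho>\<bar> * x)"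
  using norm_sin_le_exp_Im[of "\<rho> * of_real x"] norm_cos_le_exp_Im[of "\<rho> * of_real x"]
  by (simp add: osc_def abs_mult)

text \<open>
  Up to sign and a factor \<open>\<rho>\<close> for \<open>j = 0\<close>, a \<open>2 \<times> 2\<close> minor of the characteristic matrix built from
  its first row and the row of \<open>x\<close> (without the summand \<open>-1\<close>).
\<close>
definition minor :: "nat \<Rightarrow> (real \<Rightarrow> complex) \<Rightarrow> complex \<Rightarrow> real \<Rightarrow> complex" where
  "minor j f \<rho> x = osc j \<rho> x * sin_conv f \<rho> pi - osc j \<rho> pi * sin_conv f \<rho> x"

text \<open>
  Chio condensation with the entry \<open>phi j \<rho> pi\<close> as pivot. The factor \<open>\<rho>\<close> for \<open>j = 0\<close> clears the
  denominators of \<open>phi\<close>.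
\<close>
lemma det_char_matrix_condensed:
  "osc j \<rho> pi * ((if j = 0 then \<rho> else 1) * det (char_matrix a b p q j \<rho>)) =
     (osc j \<rho> pi + minor j p \<rho> a) * (osc j \<rho> pi + minor j q \<rho> b)
       - minor j q \<rho> a * minor j p \<rho> b"
  unfolding osc_eq_phi minor_def
  by (simp add: det_3 char_matrix_def vector_3 algebra_simps)

text \<open>
  Write \<open>s\<close> for \<open>osc j \<rho> pi\<close>. By condensation the difference, suitably scaled, is at most
  \<open>2 k \<bar>s\<bar> + 2 k\<^sup>2\<close>, which is less than \<open>8/9 \<bar>s\<bar>\<^sup>2\<close> as soon as \<open>3 k < \<bar>s\<bar>\<close>.
\<close>
lemma det_char_matrix_near_phi:
  assumes k: "cmod (minor j p \<rho> a) \<le> k" "cmod (minor j p \<rho> b) \<le> k"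
             "cmod (minor j q \<rho> a) \<le> k" "cmod (minor j q \<rho> b) \<le> k"
      and s: "3 * k < cmod (osc j \<rho> pi)"
  shows "cmod (det (char_matrix a b p q j \<rho>) - phi j \<rho> pi) < cmod (phi j \<rho> pi)"
proof -
  define r where "r = (if j = 0 then \<rho> else 1)"
  let ?D = "det (char_matrix a b p q j \<rho>)" and ?s = "osc j \<rho> pi"
  have k0: "0 \<le> k" using k(1) norm_ge_zero order_trans by blast
  have sr: "?s = r * phi j \<rho> pi" by (simp add: osc_eq_phi r_def)
  have r: "r \<noteq> 0" using s k0 sr by auto
  have "?s * (r * (?D - phi j \<rho> pi)) = ?s * (r * ?D) - ?s * ?s"
    by (simp add: sr algebra_simps)
  also have "\<dots> = ?s * (minor j p \<rho> a + minor j q \<rho> b)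
      + (minor j p \<rho> a * minor j q \<rho> b - minor j q \<rho> a * minor j p \<rho> b)"
    unfolding r_def det_char_matrix_condensed by (simp add: algebra_simps)
  finally have "cmod ?s * (cmod r * cmod (?D - phi j \<rho> pi)) = cmod \<dots>"
    by (metis norm_mult)
  also have "\<dots> \<le> cmod ?s * (k + k) + (k * k + k * k)"
    by (intro norm_triangle_le add_mono norm_triangle_le_diff)
       (auto simp: norm_mult simp del: mult_2 intro!: mult_left_mono mult_mono k k0
          order_trans[OF norm_triangle_ineq add_mono[OF k(1) k(4), simplified]])
  also have "\<dots> < cmod ?s * cmod ?s"
  proof -
    have "k * k \<le> k * cmod ?s" using k0 s by (intro mult_left_mono) auto
    moreover have "3 * k * cmod ?s < cmod ?s * cmod ?s"
      using s k0 by (intro mult_strict_right_mono) auto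
    moreover have "k * (3 * k) \<le> k * cmod ?s" using k0 s by (intro mult_left_mono) auto
    ultimately show ?thesis by (simp add: algebra_simps)
  qed
  finally have "cmod r * cmod (?D - phi j \<rho> pi) < cmod r * cmod (phi j \<rho> pi)"
    using s k0 by (simp add: sr norm_mult mult_less_cancel_left_pos)
  with r show ?thesis by simp
qed

section \<open>Size of the minors\<close>

lemma set_integrable_mult_bounded:
  fixes f g :: "real \<Rightarrow> complex"
  assumes f: "set_integrable lebesgue S f" and g: "g \<in> borel_measurable borel"
      and B: "\<And>t. t \<in> S \<Longrightarrow> cmod (g t) \<le> B"
  shows "set_integrable lebesgue S (\<lambda>t. g t * f t)"
  unfolding set_integrable_def
proof (rule Bochner_Integration.integrable_bound)
  let ?f = "\<lambda>t. indicator S t *\<^sub>R f t"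
  have f': "integrable lebesgue ?f" using f by (simp add: set_integrable_def)
  then show "integrable lebesgue (\<lambda>t. B *\<^sub>R ?f t)"
    by (rule Bochner_Integration.integrable_scaleR_right)
  have "g \<in> borel_measurable lebesgue"
    using g by (intro measurable_completion) simp
  with f' have "(\<lambda>t. g t * ?f t) \<in> borel_measurable lebesgue"
    by (intro borel_measurable_times) auto
  then show "(\<lambda>t. indicator S t *\<^sub>R (g t * f t)) \<in> borel_measurable lebesgue"
    by (simp add: mult_ac scaleR_conv_of_real)
  show "AE t in lebesgue. norm (indicator S t *\<^sub>R (g t * f t)) \<le> norm (B *\<^sub>R ?f t)"
    using B by (intro AE_I2) (auto simp: indicator_def norm_mult intro!: mult_right_mono intro: order_trans[OF _ abs_ge_self])
qed

text \<open>
  Moves integrals over different initial segments to the common domain \<open>(0, pi)\<close>.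
\<close>
lemma set_integral_initial_segment:
  assumes "x \<le> pi"
  shows "(LINT t:{0<..<x}|lebesgue. g t) = (LINT t:{0<..<pi}|lebesgue. if t < x then g t else (0::complex))"
  unfolding set_lebesgue_integral_def
  by (rule Bochner_Integration.integral_cong) (use assms in \<open>auto simp: indicator_def\<close>)

lemma norm_set_integral_mult_le:
  fixes f g :: "real \<Rightarrow> complex"
  assumes f: "set_integrable lebesgue S f" and g: "g \<in> borel_measurable borel"
      and B: "\<And>t. t \<in> S \<Longrightarrow> cmod (g t) \<le> B"
  shows "cmod (LINT t:S|lebesgue. g t * f t) \<le> B * (LINT t:S|lebesgue. cmod (f t))"
proof -
  have i: "set_integrable lebesgue S (\<lambda>t. g t * f t)"
    using assms by (rule set_integrable_mult_bounded)
  have "cmod (LINT t:S|lebesgue. g t * f t) \<le> (LINT t:S|lebesgue. cmod (g t * f t))"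
    by (rule set_integral_norm_bound[OF i])
  also have "\<dots> \<le> (LINT t:S|lebesgue. B * cmod (f t))"
    by (intro set_integral_mono set_integrable_norm i set_integrable_mult_right f)
       (simp add: norm_mult mult_right_mono B)
  finally show ?thesis by simp
qed

lemma sin_conv_scaled:
  "\<rho> * sin_conv f \<rho> x = (LINT t:{0<..<x}|lebesgue. sin (\<rho> * of_real (x - t)) * f t)"
  unfolding sin_conv_def sin_quot_def set_integral_mult_right[symmetric]
  by (cases "\<rho> = 0") simp_all

text \<open>
  As functions of \<open>x\<close> both sides solve \<open>u'' = - \<rho>\<^sup>2 u\<close>, vanish at \<open>x = pi\<close> and agree at \<open>x = t\<close>.
  The left side has terms of type \<open>pi + x - t\<close> in \<open>\<bar>Im \<rho>\<bar>\<close>, the right side only \<open>pi - x + t\<close>.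
\<close>
lemma osc_kernel_identity:
  "osc j \<rho> x * sin (\<rho> * of_real (pi - t)) - osc j \<rho> pi * sin (\<rho> * of_real (x - t))
     = osc j \<rho> t * sin (\<rho> * of_real (pi - x))"
  by (auto simp: osc_def right_diff_distrib sin_diff)

text \<open>
  The kernel of \<open>\<rho> * minor j f \<rho> x\<close> is \<open>osc j \<rho> t * sin (\<rho> (pi - x))\<close> for \<open>t < x\<close> and
  \<open>osc j \<rho> x * sin (\<rho> (pi - t))\<close> for \<open>t \<ge> x\<close>. In both cases the two arguments add up to at most
  \<open>pi\<close>.
\<close>
lemma norm_minor_le:
  assumes f: "set_integrable lebesgue {0<..<pi} f" and x: "0 \<le> x" "x \<le> pi"
  shows "cmod \<rho> * cmod (minor j f \<rho> x) \<le> exp (pi * \<bar>Im \<rho>\<bar>) * (LINT t:{0<..<pi}|lebesgue. cmod (f t))"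
proof -
  define g where "g t = osc j \<rho> x * sin (\<rho> * of_real (pi - t))
      - (if t < x then osc j \<rho> pi * sin (\<rho> * of_real (x - t)) else 0)" for t
  have m [measurable]: "(\<lambda>t. sin (\<rho> * of_real (y - t))) \<in> borel_measurable borel" for y
    by (intro borel_measurable_continuous_onI continuous_intros)
  have s: "cmod (sin (\<rho> * of_real y)) \<le> exp (\<bar>Im \<rho>\<bar> * y)" if "0 \<le> y" for y
    using norm_osc_le[OF that, of 0 \<rho>] by (simp add: osc_def)
  have s': "cmod (sin (\<rho> * of_real (y - t))) \<le> exp (\<bar>Im \<rho>\<bar> * pi)"
    if "0 < t" "t \<le> y" "y \<le> pi" for y t
    using that by (intro order_trans[OF s]) (auto intro: mult_left_mono)
  have bound: "cmod (g t) \<le> exp (pi * \<bar>Im \<rho>\<bar>)" if t: "t \<in> {0<..<pi}" for t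
  proof -
    have le: "exp (\<bar>Im \<rho>\<bar> * y) * exp (\<bar>Im \<rho>\<bar> * z) \<le> exp (pi * \<bar>Im \<rho>\<bar>)" if "y + z \<le> pi" for y z
      using mult_left_mono[OF that, of "\<bar>Im \<rho>\<bar>"] by (simp add: algebra_simps flip: exp_add)
    show ?thesis
    proof (cases "t < x")
      case True
      then have "cmod (g t) = cmod (osc j \<rho> t) * cmod (sin (\<rho> * of_real (pi - x)))"
        unfolding g_def using osc_kernel_identity[of j \<rho> x t] by (simp add: norm_mult)
      also have "\<dots> \<le> exp (\<bar>Im \<rho>\<bar> * t) * exp (\<bar>Im \<rho>\<bar> * (pi - x))"
        using t x by (intro mult_mono norm_osc_le s) auto
      also have "\<dots> \<le> exp (pi * \<bar>Im \<rho>\<bar>)" using True by (intro le) auto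
      finally show ?thesis .
    next
      case False
      then have "cmod (g t) = cmod (osc j \<rho> x) * cmod (sin (\<rho> * of_real (pi - t)))"
        by (simp add: g_def norm_mult)
      also have "\<dots> \<le> exp (\<bar>Im \<rho>\<bar> * x) * exp (\<bar>Im \<rho>\<bar> * (pi - t))"
        using t x by (intro mult_mono norm_osc_le s) auto
      also have "\<dots> \<le> exp (pi * \<bar>Im \<rho>\<bar>)" using False by (intro le) auto
      finally show ?thesis .
    qed
  qed
  have i1: "set_integrable lebesgue {0<..<pi} (\<lambda>t. sin (\<rho> * of_real (pi - t)) * f t)"
    by (rule set_integrable_mult_bounded[OF f m, where B = "exp (\<bar>Im \<rho>\<bar> * pi)"])
       (auto intro!: s' simp del: of_real_diff)
  have i2: "set_integrable lebesgue {0<..<pi} (\<lambda>t. (if t < x then sin (\<rho> * of_real (x - t)) else 0) * f t)"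
    by (rule set_integrable_mult_bounded[OF f, where B = "exp (\<bar>Im \<rho>\<bar> * pi)"])
       (use x in \<open>auto intro!: s' simp del: of_real_diff\<close>)
  have "\<rho> * minor j f \<rho> x = osc j \<rho> x * (\<rho> * sin_conv f \<rho> pi) - osc j \<rho> pi * (\<rho> * sin_conv f \<rho> x)"
    by (simp add: minor_def algebra_simps)
  also have "\<rho> * sin_conv f \<rho> x = (LINT t:{0<..<pi}|lebesgue. (if t < x then sin (\<rho> * of_real (x - t)) else 0) * f t)"
    unfolding sin_conv_scaled set_integral_initial_segment[OF x(2)] by (simp add: if_distrib[of "\<lambda>u. u * _"] cong: if_cong)
  also have "osc j \<rho> x * (\<rho> * sin_conv f \<rho> pi) - osc j \<rho> pi * \<dots> = (LINT t:{0<..<pi}|lebesgue. g t * f t)"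
    unfolding sin_conv_scaled set_integral_mult_right[symmetric]
      set_integral_diff(2)[OF set_integrable_mult_right[OF i1] set_integrable_mult_right[OF i2], symmetric]
    by (rule arg_cong[where f = "set_lebesgue_integral lebesgue {0<..<pi}"])
       (auto simp: fun_eq_iff g_def algebra_simps)
  finally have "cmod \<rho> * cmod (minor j f \<rho> x) = cmod \<dots>" by (metis norm_mult)
  also have "\<dots> \<le> exp (pi * \<bar>Im \<rho>\<bar>) * (LINT t:{0<..<pi}|lebesgue. cmod (f t))"
    by (rule norm_set_integral_mult_le[OF f _ bound]) (auto simp: g_def[abs_def])
  finally show ?thesis .
qed

section \<open>The characteristic function is entire\<close>

lemma sums_imp_entire:
  fixes F :: "complex \<Rightarrow> complex"
  assumes "\<And>w. (\<lambda>n. c n * w ^ n) sums F w"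
  shows "F holomorphic_on UNIV"
proof -
  have "F holomorphic_on ball 0 r" for r
    by (rule power_series_holomorphic[where a = c]) (use assms in simp)
  then have "F holomorphic_on (\<Union>r. ball 0 r)"
    by (subst holomorphic_on_UN_open) auto
  moreover have "(\<Union>r. ball (0::complex) r) = UNIV"
    by (auto intro: gt_ex)
  ultimately show ?thesis by simp
qed

text \<open>
  The power series of an even entire function contains only even powers, and the even powers of
  \<open>csqrt z\<close> are powers of \<open>z\<close>. This removes the branch cut of \<open>csqrt\<close>.
\<close>
lemma holomorphic_even_csqrt:
  assumes G: "G holomorphic_on UNIV" and even: "\<And>w. G (- w) = G w"
  shows "(\<lambda>z. G (csqrt z)) holomorphic_on UNIV"
proof (rule sums_imp_entire)
  fix z
  define c where "c n = (deriv ^^ n) G 0 / fact n" for n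
  have 1: "(\<lambda>n. c n * w ^ n) sums G w" for w
    using holomorphic_power_series[of G 0 "norm w + 1" w] holomorphic_on_subset[OF G]
    by (simp add: c_def)
  have "(\<lambda>n. (c n * w ^ n + c n * (- w) ^ n) / 2) sums ((G w + G w) / 2)" for w
    using 1[of w] 1[of "- w"] by (intro sums_divide sums_add) (auto simp: even)
  moreover have "(\<lambda>n. (c n * w ^ n + c n * (- w) ^ n) / 2) = (\<lambda>n. if even n then c n * w ^ n else 0)" for w
    by auto
  ultimately have "(\<lambda>n. if even n then c n * w ^ n else 0) sums G w" for w
    by simp
  then have "(\<lambda>n. c (2 * n) * w ^ (2 * n)) sums G w" for w
    by (subst sums_mono_reindex[of "\<lambda>n. 2 * n" "\<lambda>n. if even n then c n * w ^ n else 0" for w, simplified])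
       (auto simp: strict_mono_def image_iff elim: evenE)
  from this[of "csqrt z"] show "(\<lambda>n. c (2 * n) * z ^ n) sums G (csqrt z)"
    by (simp add: power_mult)
qed

lemma sin_quot_sums:
  "(\<lambda>n. of_real (sin_coeff (Suc n) * x ^ Suc n) * \<rho> ^ n) sums sin_quot \<rho> x"
proof (cases "\<rho> = 0")
  case True
  then show ?thesis
    using powser_sums_zero[of "\<lambda>n. complex_of_real (sin_coeff (Suc n) * x ^ Suc n)"]
    by (simp add: sin_quot_def sin_coeff_def)
next
  case False
  have "(\<lambda>n. sin_coeff (Suc n) *\<^sub>R (\<rho> * of_real x) ^ Suc n) sums sin (\<rho> * of_real x)"
    using sin_converges[of "\<rho> * of_real x"] by (subst sums_Suc_iff) simp
  from sums_divide[OF this, of \<rho>] False show ?thesis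
    by (simp add: sin_quot_def scaleR_conv_of_real power_mult_distrib mult_ac)
qed

text \<open>
  Termwise integration of \<open>sin_quot_sums\<close>. On \<open>(0, x)\<close> the terms are dominated by those of an
  exponential series times \<open>\<bar>f\<bar>\<close>.
\<close>
lemma sin_conv_sums:
  assumes f: "set_integrable lebesgue {0<..<x} f" and x: "0 \<le> x"
  shows "(\<lambda>n. (LINT t:{0<..<x}|lebesgue. of_real (sin_coeff (Suc n) * (x - t) ^ Suc n) * f t) * \<rho> ^ n)
           sums sin_conv f \<rho> x"
proof -
  let ?S = "{0<..<x}"
  define T where "T n t = of_real (sin_coeff (Suc n) * (x - t) ^ Suc n) * \<rho> ^ n" for n t
  \<comment> \<open>The dominating series, based on \<open>\<bar>sin_coeff (Suc n)\<bar> \<le> 1 / fact n\<close>.\<close>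
  define B where "B n = x * ((x * cmod \<rho>) ^ n /\<^sub>R fact n)" for n
  have B: "summable B"
    unfolding B_def by (intro summable_mult summable_exp_generic)
  have m: "T n \<in> borel_measurable borel" for n
    unfolding T_def by (intro borel_measurable_continuous_onI continuous_intros)
  have le: "cmod (T n t) \<le> B n" if t: "t \<in> ?S" for n t
  proof -
    have "\<bar>sin_coeff (Suc n)\<bar> \<le> 1 / fact n"
      by (auto simp: sin_coeff_def abs_mult power_abs fact_mono divide_left_mono
          simp del: fact_Suc)
    moreover have "\<bar>x - t\<bar> ^ Suc n \<le> x ^ Suc n"
      using t by (intro power_mono) auto
    ultimately have "\<bar>sin_coeff (Suc n)\<bar> * \<bar>x - t\<bar> ^ Suc n * cmod \<rho> ^ n
        \<le> 1 / fact n * x ^ Suc n * cmod \<rho> ^ n"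
      using x by (intro mult_mono) auto
    moreover have "cmod (T n t) = \<bar>sin_coeff (Suc n)\<bar> * \<bar>x - t\<bar> ^ Suc n * cmod \<rho> ^ n"
      unfolding T_def norm_mult norm_power norm_of_real abs_mult power_abs ..
    ultimately show ?thesis
      by (simp add: B_def power_mult_distrib field_simps)
  qed
  have i: "set_integrable lebesgue ?S (\<lambda>t. T n t * f t)" for n
    by (rule set_integrable_mult_bounded[OF f m le])
  have "(\<lambda>n. integral\<^sup>L lebesgue (\<lambda>t. indicator ?S t *\<^sub>R (T n t * f t))) sums
      (integral\<^sup>L lebesgue (\<lambda>t. \<Sum>n. indicator ?S t *\<^sub>R (T n t * f t)))"
  proof (rule sums_integral)
    show "integrable lebesgue (\<lambda>t. indicator ?S t *\<^sub>R (T n t * f t))" for n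
      using i by (simp add: set_integrable_def)
    have "summable (\<lambda>n. norm (indicator ?S t *\<^sub>R (T n t * f t)))" for t
    proof (rule summable_comparison_test')
      show "summable (\<lambda>n. B n * cmod (f t))" by (intro summable_mult2 B)
      show "norm (norm (indicator ?S t *\<^sub>R (T n t * f t))) \<le> B n * cmod (f t)" for n
        using le[of t n] x by (auto simp: indicator_def norm_mult B_def intro!: mult_right_mono)
    qed
    then show "AE t in lebesgue. summable (\<lambda>n. norm (indicator ?S t *\<^sub>R (T n t * f t)))"
      by simp
    show "summable (\<lambda>n. integral\<^sup>L lebesgue (\<lambda>t. norm (indicator ?S t *\<^sub>R (T n t * f t))))"
    proof (rule summable_comparison_test')
      show "summable (\<lambda>n. B n * (LINT t:?S|lebesgue. cmod (f t)))" by (intro summable_mult2 B)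
      fix n :: nat
      have "(integral\<^sup>L lebesgue (\<lambda>t. norm (indicator ?S t *\<^sub>R (T n t * f t)))) = (LINT t:?S|lebesgue. cmod (T n t * f t))"
        by (simp add: set_lebesgue_integral_def)
      also have "\<dots> \<le> (LINT t:?S|lebesgue. B n * cmod (f t))"
        by (intro set_integral_mono set_integrable_norm i set_integrable_mult_right f)
           (simp add: norm_mult mult_right_mono le)
      finally show "norm (integral\<^sup>L lebesgue (\<lambda>t. norm (indicator ?S t *\<^sub>R (T n t * f t))))
          \<le> B n * (LINT t:?S|lebesgue. cmod (f t))"
        by simp
    qed
  qed
  also have "(\<lambda>n. integral\<^sup>L lebesgue (\<lambda>t. indicator ?S t *\<^sub>R (T n t * f t))) =
      (\<lambda>n. (LINT t:?S|lebesgue. of_real (sin_coeff (Suc n) * (x - t) ^ Suc n) * f t) * \<rho> ^ n)"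
    unfolding set_lebesgue_integral_def[symmetric] set_integral_mult_left[symmetric] T_def
    by (simp only: mult_ac)
  also have "(integral\<^sup>L lebesgue (\<lambda>t. \<Sum>n. indicator ?S t *\<^sub>R (T n t * f t))) = sin_conv f \<rho> x"
    unfolding sin_conv_def set_lebesgue_integral_def
  proof (rule Bochner_Integration.integral_cong[OF refl])
    fix t
    have "(\<lambda>n. indicator ?S t *\<^sub>R (T n t * f t)) sums (indicator ?S t *\<^sub>R (sin_quot \<rho> (x - t) * f t))"
      unfolding T_def by (intro sums_scaleR_right sums_mult2 sin_quot_sums)
    then show "(\<Sum>n. indicator ?S t *\<^sub>R (T n t * f t)) = indicator ?S t *\<^sub>R (sin_quot \<rho> (x - t) * f t)"
      by (simp add: sums_iff)
  qed
  finally show ?thesis .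
qed

lemma phi_holomorphic: "(\<lambda>\<rho>. phi j \<rho> x) holomorphic_on UNIV"
proof (cases "j = 0")
  case True
  then show ?thesis
    using sums_imp_entire[OF sin_quot_sums, of x] by (simp add: phi_def)
next
  case False
  then show ?thesis by (auto simp: phi_def intro!: holomorphic_intros)
qed

lemma sin_conv_holomorphic:
  assumes "set_integrable lebesgue {0<..<pi} f" "0 \<le> x" "x \<le> pi"
  shows "(\<lambda>\<rho>. sin_conv f \<rho> x) holomorphic_on UNIV"
proof (rule sums_imp_entire[OF sin_conv_sums])
  show "set_integrable lebesgue {0<..<x} f"
    using assms by (auto intro: set_integrable_subset)
qed (use assms in simp)

lemma sin_quot_minus: "sin_quot (- \<rho>) x = sin_quot \<rho> x"
  by (simp add: sin_quot_def)

lemma phi_minus: "phi j (- \<rho>) x = phi j \<rho> x"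
  by (simp add: phi_def sin_quot_minus)

lemma sin_conv_minus: "sin_conv f (- \<rho>) x = sin_conv f \<rho> x"
  by (simp add: sin_conv_def sin_quot_minus)

lemma phi_csqrt_holomorphic: "(\<lambda>z. phi j (csqrt z) x) holomorphic_on UNIV"
  by (rule holomorphic_even_csqrt[OF phi_holomorphic phi_minus])

lemma char_fun_holomorphic:
  assumes "set_integrable lebesgue {0<..<pi} p" "set_integrable lebesgue {0<..<pi} q"
    and "0 \<le> a" "a \<le> pi" "0 \<le> b" "b \<le> pi"
  shows "char_fun a b p q j holomorphic_on UNIV"
proof -
  have "(\<lambda>\<rho>. det (char_matrix a b p q j \<rho>)) holomorphic_on UNIV"
    unfolding det_3 char_matrix_def vector_3
    by (intro holomorphic_intros phi_holomorphic sin_conv_holomorphic assms pi_ge_zero order_refl)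
  then have "(\<lambda>z. det (char_matrix a b p q j (csqrt z))) holomorphic_on UNIV"
    by (rule holomorphic_even_csqrt) (simp add: char_matrix_def phi_minus sin_conv_minus)
  then show ?thesis by (simp add: char_fun_def[abs_def])
qed

section \<open>Zeros of the unperturbed characteristic function\<close>

lemma phi_csqrt_eq_0_iff:
  assumes j: "j \<in> {0, 1}"
  shows "phi j (csqrt z) pi = 0 \<longleftrightarrow> (\<exists>n\<ge>1. z = of_real ((real n - real j / 2)\<^sup>2))"
proof
  assume 0: "phi j (csqrt z) pi = 0"
  then have "sin (of_real pi * (csqrt z + of_real (real j / 2))) = 0"
    by (subst osc_pi_eq_sin[OF j, symmetric]) (simp add: osc_eq_phi)
  then obtain m :: int where "of_real pi * (csqrt z + of_real (real j / 2)) = complex_of_real (m * pi)"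
    by (auto simp: sin_eq_0)
  then have "of_real pi * (csqrt z + of_real (real j / 2)) = of_real pi * complex_of_real m"
    by (simp add: mult.commute)
  then have "csqrt z + of_real (real j / 2) = complex_of_real m"
    by (subst (asm) mult_left_cancel) auto
  then have r: "csqrt z = of_real (m - real j / 2)"
    by (simp add: eq_diff_eq)
  have m: "0 \<le> m - real j / 2"
    using Re_csqrt[of z] by (simp add: r)
  have "m \<noteq> 0"
  proof
    assume "m = 0"
    with m have "j = 0" by simp
    with \<open>m = 0\<close> 0 r show False by (simp add: phi_def sin_quot_def)
  qed
  with m j have "m \<ge> 1" by auto
  then have "nat m \<ge> 1" "m - real j / 2 = real (nat m) - real j / 2" by auto
  moreover have "z = of_real ((m - real j / 2)\<^sup>2)"
    by (metis r power2_csqrt of_real_power)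
  ultimately show "\<exists>n\<ge>1. z = of_real ((real n - real j / 2)\<^sup>2)" by metis
next
  assume "\<exists>n\<ge>1. z = of_real ((real n - real j / 2)\<^sup>2)"
  then obtain n :: nat where n: "n \<ge> 1" "z = of_real ((real n - real j / 2)\<^sup>2)" by blast
  have pos: "real n - real j / 2 > 0" using n j by auto
  then have r: "csqrt z = of_real (real n - real j / 2)"
    unfolding n(2) of_real_power by (intro csqrt_square) auto
  then have "osc j (csqrt z) pi = sin (of_real pi * of_nat n)"
    by (subst osc_pi_eq_sin[OF j]) simp
  also have "\<dots> = 0"
    by (auto simp: sin_eq_0 intro: exI[of _ "int n"])
  finally show "phi j (csqrt z) pi = 0"
    using r pos by (auto simp: osc_eq_phi split: if_splits)
qed

text \<open>
  Multiplicity one is read off after the substitution \<open>z = w\<^sup>2\<close>, where the derivative of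
  \<open>w \<mapsto> osc j w pi\<close> is explicit and the branch of the root disappears.
\<close>
lemma zorder_phi_csqrt:
  assumes j: "j \<in> {0, 1}" and n: "n \<ge> 1"
  defines "\<mu> \<equiv> real n - real j / 2"
  shows "zorder (\<lambda>z. phi j (csqrt z) pi) (of_real (\<mu>\<^sup>2)) = 1"
proof (rule zorder_zero_eqI[OF phi_csqrt_holomorphic open_UNIV UNIV_I])
  let ?F = "\<lambda>z. phi j (csqrt z) pi" and ?m = "complex_of_real \<mu>"
  have \<mu>: "\<mu> > 0" using n j by (auto simp: \<mu>_def)
  have z: "?F (of_real (\<mu>\<^sup>2)) = 0"
    using phi_csqrt_eq_0_iff[OF j] n unfolding \<mu>_def by blast
  then show "(deriv ^^ i) ?F (of_real (\<mu>\<^sup>2)) = 0" if "i < nat 1" for i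
    using that by simp
  have F: "(?F has_field_derivative deriv ?F w) (at w)" for w
    by (rule holomorphic_derivI[OF phi_csqrt_holomorphic]) auto
  \<comment> \<open>The two expressions for \<open>g\<close>, by definition and by \<open>g_osc\<close>, are differentiated at \<open>\<mu>\<close>; comparing gives \<open>deriv ?F\<close>.\<close>
  define g where "g w = (if j = 0 then w else 1) * ?F (w\<^sup>2)" for w
  have "csqrt (w\<^sup>2) = w \<or> csqrt (w\<^sup>2) = - w" for w
    using power2_csqrt[of "w\<^sup>2"] by (simp only: power2_eq_iff)
  then have "phi j (csqrt (w\<^sup>2)) pi = phi j w pi" for w
    by (metis phi_minus)
  then have g_osc: "g w = osc j w pi" for w
    by (simp add: g_def osc_eq_phi)
  have "(g has_field_derivative ((if j = 0 then ?m else 1) * (deriv ?F (?m\<^sup>2) * (2 * ?m)))) (at ?m)"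
  proof -
    have D: "((\<lambda>w. ?F (w\<^sup>2)) has_field_derivative deriv ?F (?m\<^sup>2) * (2 * ?m)) (at ?m)"
      by (rule DERIV_chain2[OF F]) (auto intro!: derivative_eq_intros)
    have "?F (?m\<^sup>2) = 0" using z by (simp only: of_real_power)
    with DERIV_mult[OF DERIV_ident D] D show ?thesis
      unfolding g_def by (cases "j = 0") (simp_all add: mult_ac)
  qed
  moreover have "(g has_field_derivative (of_real pi * cos (of_real pi * (?m + of_real (real j / 2))))) (at ?m)"
    unfolding g_osc osc_pi_eq_sin[OF j]
    by (auto intro!: derivative_eq_intros)
  ultimately have "(if j = 0 then ?m else 1) * (deriv ?F (?m\<^sup>2) * (2 * ?m)) =
      of_real pi * cos (of_real pi * (?m + of_real (real j / 2)))"
    by (rule DERIV_unique)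
  also have "?m + of_real (real j / 2) = of_nat n" by (simp add: \<mu>_def)
  also have "of_real pi * cos (of_real pi * of_nat n) \<noteq> (0 :: complex)"
  proof -
    have "cos (complex_of_real pi * of_nat n) = of_real (cos (pi * real n))"
      by (metis cos_of_real of_real_mult of_real_of_nat_eq)
    then show ?thesis by (simp add: cos_npi)
  qed
  finally show "(deriv ^^ nat 1) ?F (of_real (\<mu>\<^sup>2)) \<noteq> 0" by auto
qed auto

text \<open>
  The radius is the square of the midpoint between the consecutive grid points \<open>N - j/2\<close> and
  \<open>N + 1 - j/2\<close>, so exactly the first \<open>N\<close> simple zeros are counted.
\<close>
lemma sum_zorder_phi_csqrt:
  assumes j: "j \<in> {0, 1}"
  defines "f \<equiv> \<lambda>z. phi j (csqrt z) pi"
  shows "(\<Sum>z | cmod z < (real N + 1/2 - real j / 2)\<^sup>2 \<and> f z = 0. zorder f z) = int N"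
proof -
  define \<mu> where "\<mu> n = real n - real j / 2" for n
  define z where "z n = complex_of_real ((\<mu> n)\<^sup>2)" for n
  have \<mu>: "\<mu> n > 0" if "n \<ge> 1" for n using that j by (auto simp: \<mu>_def)
  have "cmod (z n) < (real N + 1/2 - real j / 2)\<^sup>2 \<longleftrightarrow> n \<le> N" if "n \<ge> 1" for n
  proof -
    have "real N + 1/2 - real j / 2 \<ge> 0" using j by auto
    then have "(\<mu> n)\<^sup>2 < (real N + 1/2 - real j / 2)\<^sup>2 \<longleftrightarrow> \<mu> n < real N + 1/2 - real j / 2"
      using \<mu>[OF that] by (intro iffI power_strict_mono) (auto intro: power2_less_imp_less)
    also have "\<dots> \<longleftrightarrow> n \<le> N" by (auto simp: \<mu>_def)
    finally show ?thesis by (simp add: z_def norm_power)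
  qed
  then have "{w. cmod w < (real N + 1/2 - real j / 2)\<^sup>2 \<and> f w = 0} = z ` {1..N}"
    using phi_csqrt_eq_0_iff[OF j] by (auto simp: f_def z_def \<mu>_def)
  moreover have "inj_on z {1..N}"
  proof (rule inj_onI)
    fix m n assume mn: "m \<in> {1..N}" "n \<in> {1..N}" "z m = z n"
    then have "(\<mu> m)\<^sup>2 = (\<mu> n)\<^sup>2" by (simp add: z_def del: of_real_power)
    then have "\<mu> m = \<mu> n" using \<mu>[of m] \<mu>[of n] mn by (simp add: power2_eq_iff)
    then show "m = n" by (simp add: \<mu>_def)
  qed
  moreover have "zorder f (z n) = 1" if "n \<in> {1..N}" for n
    using zorder_phi_csqrt[OF j, of n] that by (simp add: f_def z_def \<mu>_def)
  ultimately show ?thesis by (simp add: sum.reindex)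
qed

section \<open>Counting and listing zeros\<close>

lemma finite_zeros_in_cball:
  assumes h: "h holomorphic_on UNIV" and w: "h w \<noteq> 0"
  shows "finite {z. cmod z \<le> r \<and> h z = 0}"
proof (cases "h constant_on UNIV")
  case True
  with w show ?thesis by (auto simp: constant_on_def)
next
  case False
  then show ?thesis
    using holomorphic_compact_finite_zeros[OF h, of "cball 0 r"] connected_UNIV by simp
qed

text \<open>
  Rouche's theorem for the circle of radius \<open>r\<close> with the winding numbers evaluated. The strict
  inequality also shows that neither function vanishes on the circle.
\<close>
lemma Rouche_disc:
  fixes f g :: "complex \<Rightarrow> complex"
  assumes f: "f holomorphic_on UNIV" and g: "g holomorphic_on UNIV" and r: "r > 0"
    and less: "\<And>z. cmod z = r \<Longrightarrow> cmod (g z - f z) < cmod (f z)"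
  shows "(\<Sum>z | cmod z < r \<and> g z = 0. zorder g z) = (\<Sum>z | cmod z < r \<and> f z = 0. zorder f z)"
proof -
  let ?\<gamma> = "circlepath 0 r" and ?s = "ball (0::complex) (r + 1)"
  have fin: "finite {z \<in> ?s. h z = 0}" if "h holomorphic_on UNIV" "\<And>z. cmod z = r \<Longrightarrow> h z \<noteq> 0" for h
    by (rule finite_subset[OF _ finite_zeros_in_cball[of h "of_real r" "r + 1"]]) (use that r in auto)
  have nz: "f z \<noteq> 0" "g z \<noteq> 0" if "cmod z = r" for z
    using less[OF that] by auto
  have sum: "(\<Sum>z \<in> {z \<in> ?s. h z = 0}. winding_number ?\<gamma> z * zorder h z)
      = of_int (\<Sum>z | cmod z < r \<and> h z = 0. zorder h z)"
    if h: "h holomorphic_on UNIV" "\<And>z. cmod z = r \<Longrightarrow> h z \<noteq> 0" for h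
  proof -
    have "(\<Sum>z \<in> {z \<in> ?s. h z = 0}. winding_number ?\<gamma> z * zorder h z)
        = (\<Sum>z | cmod z < r \<and> h z = 0. winding_number ?\<gamma> z * zorder h z)"
    proof (rule sum.mono_neutral_right[OF fin[OF h]])
      have "winding_number ?\<gamma> z = 0" if "cmod z > r" for z
        by (rule winding_number_zero_outside[of _ "cball 0 r"]) (use that r in auto)
      then show "\<forall>z \<in> {z \<in> ?s. h z = 0} - {z. cmod z < r \<and> h z = 0}. winding_number ?\<gamma> z * zorder h z = 0"
        using h(2) by (auto simp: not_less) (metis linorder_neqE_linordered_idom)
    qed auto
    also have "\<dots> = (\<Sum>z | cmod z < r \<and> h z = 0. of_int (zorder h z))"
      by (intro sum.cong refl) (simp add: winding_number_circlepath)
    finally show ?thesis by simp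
  qed
  have "(\<Sum>z \<in> {z \<in> ?s. f z + (g z - f z) = 0}. winding_number ?\<gamma> z * zorder (\<lambda>z. f z + (g z - f z)) z)
      = (\<Sum>z \<in> {z \<in> ?s. f z = 0}. winding_number ?\<gamma> z * zorder f z)"
  proof (rule Rouche_theorem[of ?s f "\<lambda>z. g z - f z" ?\<gamma>])
    show "finite {z \<in> ?s. f z = 0}" "finite {z \<in> ?s. f z + (g z - f z) = 0}"
      using fin[OF f nz(1)] fin[OF g nz(2)] by simp_all
    show "f holomorphic_on ?s" "(\<lambda>z. g z - f z) holomorphic_on ?s"
      using f g by (auto intro!: holomorphic_intros intro: holomorphic_on_subset)
    show "\<forall>z \<in> path_image ?\<gamma>. cmod (g z - f z) < cmod (f z)"
      using less r by simp
    show "\<forall>z. z \<notin> ?s \<longrightarrow> winding_number ?\<gamma> z = 0"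
      using r by (auto intro!: winding_number_zero_outside[of _ "cball 0 r"])
  qed (use r in auto)
  then have "(\<Sum>z \<in> {z \<in> ?s. g z = 0}. winding_number ?\<gamma> z * zorder g z)
      = (\<Sum>z \<in> {z \<in> ?s. f z = 0}. winding_number ?\<gamma> z * zorder f z)" by simp
  then show ?thesis
    using sum[OF f nz(1)] sum[OF g nz(2)] by (metis (no_types, lifting) of_int_eq_iff)
qed

text \<open>
  Greedy choice: remove again and again an element with the least value of \<open>h\<close>. An element that
  is never chosen would bound \<open>h\<close> on infinitely many chosen ones.
\<close>
lemma sorted_enumeration_exists:
  fixes h :: "'a \<Rightarrow> real"
  assumes inf: "infinite S" and fin: "\<And>r. finite {s \<in> S. h s \<le> r}"
  shows "\<exists>e :: nat \<Rightarrow> 'a. bij_betw e UNIV S \<and> (\<forall>m n. m \<le> n \<longrightarrow> h (e m) \<le> h (e n))"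
proof -
  have ex: "\<exists>s. s \<in> S - T \<and> (\<forall>t \<in> S - T. h s \<le> h t)" if "finite T" for T
  proof -
    have "infinite (S - T)" using inf that by simp
    then obtain s0 where s0: "s0 \<in> S - T" by (metis ex_in_conv finite.emptyI)
    define X where "X = {s \<in> S. h s \<le> h s0} - T"
    have X: "finite X" "X \<noteq> {}" using fin s0 by (auto simp: X_def)
    define s where "s = arg_min_on h X"
    have s: "s \<in> X" "\<And>t. t \<in> X \<Longrightarrow> h s \<le> h t"
      using arg_min_if_finite[OF X, of h] by (auto simp: s_def not_less)
    have "h s \<le> h t" if t: "t \<in> S - T" for t
    proof (cases "h t \<le> h s0")
      case True
      with t show ?thesis by (intro s(2)) (auto simp: X_def)
    next
      case False
      with s(1) show ?thesis by (simp add: X_def)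
    qed
    with s(1) show ?thesis by (auto simp: X_def)
  qed
  define nxt where "nxt T = (SOME s. s \<in> S - T \<and> (\<forall>t \<in> S - T. h s \<le> h t))" for T
  have nxt: "nxt T \<in> S - T \<and> (\<forall>t \<in> S - T. h (nxt T) \<le> h t)" if "finite T" for T
    unfolding nxt_def by (rule someI_ex[OF ex[OF that]])
  define T where "T = rec_nat {} (\<lambda>_ A. insert (nxt A) A)"
  have T0: "T 0 = {}" and TS: "T (Suc n) = insert (nxt (T n)) (T n)" for n
    by (simp_all add: T_def)
  have finT: "finite (T n)" for n by (induction n) (auto simp: T0 TS)
  define e where "e n = nxt (T n)" for n
  have Te: "T n = e ` {..<n}" for n
    by (induction n) (auto simp: T0 TS e_def lessThan_Suc)
  have e: "e n \<in> S" "e n \<notin> T n" "\<And>t. t \<in> S \<Longrightarrow> t \<notin> T n \<Longrightarrow> h (e n) \<le> h t" for n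
    using nxt[OF finT[of n]] by (auto simp: e_def)
  have inj: "inj e"
  proof (rule linorder_injI)
    show "e m \<noteq> e n" if "m < n" for m n
    proof -
      have "e m \<in> T n" using that by (simp add: Te)
      with e(2)[of n] show ?thesis by metis
    qed
  qed
  have "h (e n) \<le> h (e (Suc n))" for n
    using e(1,2)[of "Suc n"] by (intro e(3)) (auto simp: TS)
  then have mono: "h (e m) \<le> h (e n)" if "m \<le> n" for m n
    using lift_Suc_mono_le[of "\<lambda>n. h (e n)"] that by blast
  have "S \<subseteq> range e"
  proof
    fix s assume s: "s \<in> S"
    show "s \<in> range e"
    proof (rule ccontr)
      assume "s \<notin> range e"
      then have "s \<notin> T n" for n by (auto simp: Te)
      then have "range e \<subseteq> {t \<in> S. h t \<le> h s}"
        using e(1,3) s by auto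
      then show False
        using fin inj by (meson finite_imageD finite_subset infinite_UNIV_nat)
    qed
  qed
  then have "bij_betw e UNIV S"
    using inj e(1) by (auto simp: bij_betw_def)
  then show ?thesis using mono by blast
qed

text \<open>
  The defining property of a spectrum, for an arbitrary function in place of the characteristic
  function.
\<close>
definition lists_zeros :: "(complex \<Rightarrow> complex) \<Rightarrow> (nat \<Rightarrow> complex) \<Rightarrow> bool" where
  "lists_zeros D ev \<longleftrightarrow>
     (\<forall>n\<ge>1. D (ev n) = 0) \<and>
     (\<forall>z. D z = 0 \<longrightarrow>
        finite {n. 1 \<le> n \<and> ev n = z} \<and> int (card {n. 1 \<le> n \<and> ev n = z}) = zorder D z) \<and>
     (\<forall>m n. 1 \<le> m \<and> m \<le> n \<longrightarrow> cmod (ev m) \<le> cmod (ev n))"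

text \<open>
  The indices \<open>n \<ge> 1\<close> with \<open>\<bar>ev n\<bar> < r\<close> form an initial segment, since \<open>\<bar>ev n\<bar>\<close> is nondecreasing,
  and there are as many of them as zeros in the disc.
\<close>
lemma lists_zeros_disc:
  assumes ev: "lists_zeros D ev" and D: "D holomorphic_on UNIV" "D w \<noteq> 0"
    and N: "(\<Sum>z | cmod z < r \<and> D z = 0. zorder D z) = int N" and n: "n \<ge> 1"
  shows "cmod (ev n) < r \<longleftrightarrow> n \<le> N"
proof -
  define A where "A = {n. 1 \<le> n \<and> cmod (ev n) < r}"
  let ?Z = "{z. cmod z < r \<and> D z = 0}"
  have fZ: "finite ?Z"
    by (rule finite_subset[OF _ finite_zeros_in_cball[OF D, of r]]) auto
  have A: "A = (\<Union>z\<in>?Z. {n. 1 \<le> n \<and> ev n = z})"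
    using ev by (auto simp: A_def lists_zeros_def)
  have fA: "finite A"
    unfolding A using fZ ev by (auto simp: lists_zeros_def)
  have "int (card A) = (\<Sum>z\<in>?Z. int (card {n. 1 \<le> n \<and> ev n = z}))"
    unfolding A using fZ ev by (subst card_UN_disjoint) (auto simp: lists_zeros_def)
  also have "\<dots> = (\<Sum>z\<in>?Z. zorder D z)"
    using ev by (intro sum.cong) (auto simp: lists_zeros_def)
  finally have cA: "card A = N" using N by simp
  have down: "{1..m} \<subseteq> A" if "m \<in> A" for m
    using that ev by (fastforce simp: A_def lists_zeros_def)
  have "A \<subseteq> {1..N}"
  proof
    fix m assume m: "m \<in> A"
    from card_mono[OF fA down[OF m]] cA have "m \<le> N" by simp
    with m show "m \<in> {1..N}" by (simp add: A_def)
  qed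
  then have "A = {1..N}" using cA by (intro card_subset_eq) auto
  then have "n \<in> A \<longleftrightarrow> n \<in> {1..N}" by (rule arg_cong)
  with n show ?thesis by (simp add: A_def)
qed

text \<open>
  A zero \<open>z\<close> of multiplicity \<open>c\<close> is represented by the \<open>c\<close> pairs \<open>(z, i)\<close>, \<open>i < c\<close>. Unbounded
  counts make the set of these pairs infinite, so it can be enumerated by the modulus of the first
  component.
\<close>
lemma lists_zeros_exists:
  assumes D: "D holomorphic_on UNIV" "D w \<noteq> 0"
    and N: "\<And>N. N \<ge> N0 \<Longrightarrow> (\<Sum>z | cmod z < r N \<and> D z = 0. zorder D z) = int N"
  shows "\<exists>ev. lists_zeros D ev"
proof -
  define c where "c z = nat (zorder D z)" for z
  have pos: "zorder D z > 0" if "D z = 0" for z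
  proof -
    have "eventually (\<lambda>z. D z \<noteq> 0 \<and> z \<in> UNIV) (at z)"
      by (rule non_zero_neighbour_alt[OF D(1)]) (use D(2) in auto)
    then have "frequently (\<lambda>z. D z \<noteq> 0) (at z)"
      by (intro eventually_frequently) auto
    then show ?thesis using zorder_pos_iff[OF D(1) open_UNIV UNIV_I] that by blast
  qed
  define S where "S = Sigma {z. D z = 0} (\<lambda>z. {..<c z})"
  have fin: "finite {s \<in> S. cmod (fst s) \<le> r}" for r
  proof -
    have "{s \<in> S. cmod (fst s) \<le> r} = Sigma {z. cmod z \<le> r \<and> D z = 0} (\<lambda>z. {..<c z})"
      by (auto simp: S_def)
    then show ?thesis using finite_zeros_in_cball[OF D] by auto
  qed
  have inf: "infinite S"
  proof
    assume S: "finite S"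
    define N where "N = max N0 (Suc (card S))"
    let ?Z = "{z. cmod z < r N \<and> D z = 0}"
    have fZ: "finite ?Z"
      by (rule finite_subset[OF _ finite_zeros_in_cball[OF D, of "r N"]]) auto
    have "int N = (\<Sum>z\<in>?Z. int (c z))"
      unfolding N[of N, unfolded N_def, OF max.cobounded1, folded N_def, symmetric]
      using pos by (intro sum.cong) (auto simp: c_def less_imp_le)
    also have "\<dots> = int (card (Sigma ?Z (\<lambda>z. {..<c z})))"
      using fZ by (subst card_SigmaI) auto
    also have "\<dots> \<le> int (card S)"
      using S by (auto simp: S_def intro!: card_mono)
    finally show False by (simp add: N_def)
  qed
  have "\<exists>e :: nat \<Rightarrow> complex \<times> nat. bij_betw e UNIV S \<and>
      (\<forall>m n. m \<le> n \<longrightarrow> cmod (fst (e m)) \<le> cmod (fst (e n)))"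
    by (rule sorted_enumeration_exists[OF inf fin])
  then obtain e :: "nat \<Rightarrow> complex \<times> nat" where e: "bij_betw e UNIV S \<and>
      (\<forall>m n. m \<le> n \<longrightarrow> cmod (fst (e m)) \<le> cmod (fst (e n)))" ..
  define ev where "ev n = fst (e (n - 1))" for n
  have "lists_zeros D ev"
    unfolding lists_zeros_def
  proof (intro conjI allI impI)
    show "D (ev n) = 0" for n
    proof -
      have "e (n - 1) \<in> S" using bij_betwE[OF conjunct1[OF e]] by simp
      then show ?thesis by (auto simp: ev_def S_def)
    qed
    show "cmod (ev m) \<le> cmod (ev n)" if "1 \<le> m \<and> m \<le> n" for m n
    proof -
      have "m - 1 \<le> n - 1" using that by (simp add: diff_le_mono)
      with e show ?thesis unfolding ev_def by blast
    qed
    fix z assume z: "D z = 0"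
    have inj: "inj e" and surj: "range e = S" using e by (auto simp: bij_betw_def)
    have "bij_betw (\<lambda>n. e (n - 1)) {n. 1 \<le> n \<and> ev n = z} ({z} \<times> {..<c z})"
    proof (rule bij_betw_imageI)
      show "inj_on (\<lambda>n. e (n - 1)) {n. 1 \<le> n \<and> ev n = z}"
      proof (rule inj_onI)
        fix m n assume mn: "m \<in> {n. 1 \<le> n \<and> ev n = z}" "n \<in> {n. 1 \<le> n \<and> ev n = z}"
          and eq: "e (m - 1) = e (n - 1)"
        from eq have "m - 1 = n - 1" by (rule injD[OF inj])
        with mn show "m = n" by (cases m; cases n) auto
      qed
      show "(\<lambda>n. e (n - 1)) ` {n. 1 \<le> n \<and> ev n = z} = {z} \<times> {..<c z}"
      proof (intro equalityI subsetI)
        fix s assume "s \<in> (\<lambda>n. e (n - 1)) ` {n. 1 \<le> n \<and> ev n = z}"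
        then obtain n where "s = e (n - 1)" "fst s = z" by (auto simp: ev_def)
        moreover have "s \<in> S" using \<open>s = e (n - 1)\<close> surj by blast
        ultimately show "s \<in> {z} \<times> {..<c z}" by (auto simp: S_def)
      next
        fix s assume s: "s \<in> {z} \<times> {..<c z}"
        then have "s \<in> S" using z by (auto simp: S_def)
        then obtain n where "s = e n" using surj by blast
        with s show "s \<in> (\<lambda>n. e (n - 1)) ` {n. 1 \<le> n \<and> ev n = z}"
          by (intro image_eqI[of _ _ "Suc n"]) (auto simp: ev_def)
      qed
    qed
    then have "finite {n. 1 \<le> n \<and> ev n = z}" "card {n. 1 \<le> n \<and> ev n = z} = c z"
      using bij_betw_finite[of _ "{n. 1 \<le> n \<and> ev n = z}" "{z} \<times> {..<c z}"]
        bij_betw_same_card[of _ "{n. 1 \<le> n \<and> ev n = z}" "{z} \<times> {..<c z}"]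
      by auto
    then show "finite {n. 1 \<le> n \<and> ev n = z}" "int (card {n. 1 \<le> n \<and> ev n = z}) = zorder D z"
      using pos[OF z] by (simp_all add: c_def)
  qed
  then show ?thesis by (rule exI[of "lists_zeros D" ev])
qed

section \<open>Localization of the zeros\<close>

text \<open>
  A point of the circle close to the real axis is close to \<open>N + 1/2 - j/2\<close>, midway between two grid
  points; away from the real axis the imaginary part alone keeps the distance to the grid above
  \<open>1/4\<close>.
\<close>
lemma norm_osc_pi_ge_on_circle:
  assumes j: "j \<in> {0, 1}" and N: "N \<ge> 1" and \<rho>: "cmod \<rho> = real N + 1/2 - real j / 2" "Re \<rho> \<ge> 0"
  shows "exp (pi * \<bar>Im \<rho>\<bar>) / 32 \<le> cmod (osc j \<rho> pi)"
proof -
  define w where "w = \<rho> + of_real (real j / 2)"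
  define m where "m = round (Re w)"
  have m: "\<bar>Re w - m\<bar> \<le> 1/2"
    using of_int_round_abs_le[of "Re w"] by (simp add: m_def abs_minus_commute)
  have "1/4 \<le> cmod (w - m)"
  proof (rule ccontr)
    assume "\<not> 1/4 \<le> cmod (w - m)"
    then have u: "\<bar>Re w - m\<bar> < 1/4" "\<bar>Im \<rho>\<bar> < 1/4"
      using abs_Re_le_cmod[of "w - m"] abs_Im_le_cmod[of "w - m"] by (auto simp: w_def)
    have R1: "cmod \<rho> \<ge> 1" using N j by (auto simp: \<rho>)
    have le: "Re \<rho> \<le> cmod \<rho>" by (rule complex_Re_le_cmod)
    \<comment> \<open>A small imaginary part puts \<open>Re \<rho>\<close> within \<open>1/16\<close> of the radius.\<close>
    have "(cmod \<rho> - Re \<rho>) * 1 \<le> (cmod \<rho> - Re \<rho>) * (cmod \<rho> + Re \<rho>)"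
      using R1 \<rho>(2) le by (intro mult_left_mono) auto
    also have "\<dots> = \<bar>Im \<rho>\<bar>\<^sup>2"
      using cmod_power2[of \<rho>] by (simp add: power2_eq_square algebra_simps)
    also have "\<dots> \<le> (1/4)\<^sup>2" using u(2) by (intro power_mono) auto
    finally have "cmod \<rho> - Re \<rho> \<le> 1/16" by (simp add: power2_eq_square)
    with le have "real N + 7/16 \<le> Re w" "Re w \<le> real N + 1/2"
      by (auto simp: w_def \<rho>(1))
    with u(1) have "real_of_int m < real_of_int (int N + 1)" "real_of_int (int N) < real_of_int m"
      by (auto simp: abs_if split: if_splits)
    then show False unfolding of_int_less_iff by simp
  qed
  then have "exp (pi * \<bar>Im \<rho>\<bar>) * (1/4) / 8 \<le> exp (pi * \<bar>Im w\<bar>) * min 1 (cmod (w - m)) / 8"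
    by (intro divide_right_mono mult_mono) (auto simp: w_def)
  also have "\<dots> \<le> cmod (osc j \<rho> pi)"
    unfolding osc_pi_eq_sin[OF j] w_def[symmetric] by (rule norm_sin_pi_ge[OF m])
  finally show ?thesis by simp
qed

lemma char_fun_near_phi:
  assumes p: "set_integrable lebesgue {0<..<pi} p" and q: "set_integrable lebesgue {0<..<pi} q"
    and ab: "0 \<le> a" "a \<le> pi" "0 \<le> b" "b \<le> pi"
    and z: "z \<noteq> 0"
    and C: "(LINT t:{0<..<pi}|lebesgue. cmod (p t)) \<le> C" "(LINT t:{0<..<pi}|lebesgue. cmod (q t)) \<le> C"
    and large: "3 * C * exp (pi * \<bar>Im (csqrt z)\<bar>) < cmod (csqrt z) * cmod (osc j (csqrt z) pi)"
  shows "cmod (char_fun a b p q j z - phi j (csqrt z) pi) < cmod (phi j (csqrt z) pi)"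
proof -
  define \<rho> where "\<rho> = csqrt z"
  have \<rho>: "cmod \<rho> > 0" using z by (simp add: \<rho>_def)
  define k where "k = C * exp (pi * \<bar>Im \<rho>\<bar>) / cmod \<rho>"
  have k: "cmod (minor j f \<rho> x) \<le> k"
    if "set_integrable lebesgue {0<..<pi} f" "0 \<le> x" "x \<le> pi"
       "(LINT t:{0<..<pi}|lebesgue. cmod (f t)) \<le> C" for f x
  proof -
    have "cmod \<rho> * cmod (minor j f \<rho> x) \<le> exp (pi * \<bar>Im \<rho>\<bar>) * C"
      by (rule order_trans[OF norm_minor_le[OF that(1-3)]]) (use that in auto)
    with \<rho> show ?thesis by (simp add: k_def field_simps)
  qed
  have "3 * k < cmod (osc j \<rho> pi)"
    using large \<rho> by (simp add: k_def \<rho>_def[symmetric] field_simps)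
  with p q ab C show ?thesis
    unfolding char_fun_def \<rho>_def[symmetric] by (intro det_char_matrix_near_phi[of _ _ _ _ k] k)
qed

text \<open>
  The constant 96 is the product of the 3 of \<open>char_fun_near_phi\<close> and the 32 of
  \<open>norm_osc_pi_ge_on_circle\<close>.
\<close>
lemma sum_zorder_char_fun:
  assumes p: "set_integrable lebesgue {0<..<pi} p" and q: "set_integrable lebesgue {0<..<pi} q"
    and ab: "0 \<le> a" "a \<le> pi" "0 \<le> b" "b \<le> pi" and j: "j \<in> {0, 1}"
    and C: "(LINT t:{0<..<pi}|lebesgue. cmod (p t)) \<le> C" "(LINT t:{0<..<pi}|lebesgue. cmod (q t)) \<le> C"
    and N: "N \<ge> 1" "96 * C < real N"
  shows "char_fun a b p q j (of_real ((real N + 1/2 - real j / 2)\<^sup>2)) \<noteq> 0"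
    and "(\<Sum>z | cmod z < (real N + 1/2 - real j / 2)\<^sup>2 \<and> char_fun a b p q j z = 0.
           zorder (char_fun a b p q j) z) = int N"
proof -
  define R where "R = real N + 1/2 - real j / 2"
  have R: "R \<ge> real N" "R > 0" using N j by (auto simp: R_def)
  have near: "cmod (char_fun a b p q j z - phi j (csqrt z) pi) < cmod (phi j (csqrt z) pi)"
    if z: "cmod z = R\<^sup>2" for z
  proof (rule char_fun_near_phi[OF p q ab _ C])
    have \<rho>: "cmod (csqrt z) = R"
      using z R by (metis norm_power power2_csqrt norm_ge_zero less_imp_le power2_eq_imp_eq)
    show "z \<noteq> 0" using z R by auto
    have "3 * C * exp (pi * \<bar>Im (csqrt z)\<bar>) = 96 * C * (exp (pi * \<bar>Im (csqrt z)\<bar>) / 32)" by simp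
    also have "\<dots> < R * (exp (pi * \<bar>Im (csqrt z)\<bar>) / 32)"
      using N R by (intro mult_strict_right_mono) auto
    also have "\<dots> \<le> R * cmod (osc j (csqrt z) pi)"
      using R \<rho>[unfolded R_def]
      by (intro mult_left_mono norm_osc_pi_ge_on_circle[OF j N(1)] Re_csqrt) simp_all
    finally show "3 * C * exp (pi * \<bar>Im (csqrt z)\<bar>) < cmod (csqrt z) * cmod (osc j (csqrt z) pi)"
      unfolding \<rho> .
  qed
  from near[of "of_real (R\<^sup>2)"] show "char_fun a b p q j (of_real ((real N + 1/2 - real j / 2)\<^sup>2)) \<noteq> 0"
    by (auto simp: R_def[symmetric] norm_power)
  have "(\<Sum>z | cmod z < R\<^sup>2 \<and> char_fun a b p q j z = 0. zorder (char_fun a b p q j) z) =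
      (\<Sum>z | cmod z < R\<^sup>2 \<and> phi j (csqrt z) pi = 0. zorder (\<lambda>z. phi j (csqrt z) pi) z)"
    using R by (intro Rouche_disc phi_csqrt_holomorphic char_fun_holomorphic p q ab near) auto
  also have "\<dots> = int N"
    unfolding R_def by (rule sum_zorder_phi_csqrt[OF j])
  finally show "(\<Sum>z | cmod z < (real N + 1/2 - real j / 2)\<^sup>2 \<and> char_fun a b p q j z = 0.
           zorder (char_fun a b p q j) z) = int N"
    unfolding R_def .
qed

text \<open>
  At a zero the comparison of \<open>char_fun_near_phi\<close> must fail, so the sine is small compared with
  \<open>exp (pi \<bar>Im \<rho>\<bar>)\<close> and \<open>\<rho> + j/2\<close> is near some integer; the annulus identifies this integer as \<open>n\<close>.
  The bound \<open>384 C < n\<close> makes \<open>48 C / n\<close> less than \<open>1/8\<close>.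
\<close>
lemma zero_near_grid:
  assumes p: "set_integrable lebesgue {0<..<pi} p" and q: "set_integrable lebesgue {0<..<pi} q"
    and ab: "0 \<le> a" "a \<le> pi" "0 \<le> b" "b \<le> pi" and j: "j \<in> {0, 1}"
    and C: "(LINT t:{0<..<pi}|lebesgue. cmod (p t)) \<le> C" "(LINT t:{0<..<pi}|lebesgue. cmod (q t)) \<le> C"
    and n: "n \<ge> 2" "384 * C < real n"
    and z: "char_fun a b p q j z = 0"
    and annulus: "real n - 1/2 - real j / 2 \<le> cmod (csqrt z)" "cmod (csqrt z) < real n + 1/2 - real j / 2"
  defines "u \<equiv> csqrt z - of_real (real n - real j / 2)"
  shows "cmod u \<le> 48 * C / real n" "cmod u \<le> 1/8"
    and "exp (pi * \<bar>Im (csqrt z)\<bar>) * cmod u / 8 \<le> cmod (osc j (csqrt z) pi)"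
proof -
  define \<rho> where "\<rho> = csqrt z"
  define w where "w = \<rho> + of_real (real j / 2)"
  define m where "m = round (Re w)"
  define E where "E = exp (pi * \<bar>Im \<rho>\<bar>)"
  have E: "E > 0" by (simp add: E_def)
  have m: "\<bar>Re w - m\<bar> \<le> 1/2"
    using of_int_round_abs_le[of "Re w"] by (simp add: m_def abs_minus_commute)
  have \<rho>n: "cmod \<rho> \<ge> real n / 2" using annulus(1) n j by (auto simp: \<rho>_def)
  then have z0: "z \<noteq> 0" using n by (auto simp: \<rho>_def)
  have "cmod \<rho> * cmod (osc j \<rho> pi) \<le> 3 * C * E"
    using char_fun_near_phi[OF p q ab z0 C, of j] z by (fastforce simp: \<rho>_def E_def)
  moreover have low: "E * min 1 (cmod (w - m)) / 8 \<le> cmod (osc j \<rho> pi)"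
    using norm_sin_pi_ge[OF m] unfolding osc_pi_eq_sin[OF j] w_def[symmetric] by (simp add: E_def w_def)
  then have "cmod \<rho> * (E * min 1 (cmod (w - m)) / 8) \<le> cmod \<rho> * cmod (osc j \<rho> pi)"
    by (rule mult_left_mono) simp
  ultimately have "E * (cmod \<rho> * min 1 (cmod (w - m))) \<le> E * (24 * C)"
    by (simp add: mult_ac)
  then have "cmod \<rho> * min 1 (cmod (w - m)) \<le> 24 * C"
    using E by (simp add: mult_le_cancel_left_pos)
  moreover have "real n / 2 * min 1 (cmod (w - m)) \<le> cmod \<rho> * min 1 (cmod (w - m))"
    using \<rho>n by (intro mult_right_mono) auto
  ultimately have nu: "min 1 (cmod (w - m)) \<le> 48 * C / real n"
    using n by (simp add: field_simps)
  also have "\<dots> < 1/8" using n by (simp add: field_simps)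
  finally have small: "cmod (w - m) < 1/8" by (simp add: min_def split: if_splits)
  then have Re: "\<bar>Re w - m\<bar> < 1/8" and Im: "\<bar>Im \<rho>\<bar> < 1/8"
    using abs_Re_le_cmod[of "w - m"] abs_Im_le_cmod[of "w - m"] by (auto simp: w_def)
  have "cmod \<rho> \<le> \<bar>Re \<rho>\<bar> + \<bar>Im \<rho>\<bar>" by (rule cmod_le)
  moreover have "\<bar>Re \<rho>\<bar> = Re \<rho>" using Re_csqrt[of z] by (simp add: \<rho>_def)
  moreover have "Re \<rho> \<le> cmod \<rho>" by (rule complex_Re_le_cmod)
  ultimately have "Re w > real n - 5/8" "Re w < real n + 1/2"
    using Im annulus[folded \<rho>_def] by (auto simp: w_def)
  with Re have "real_of_int m < real_of_int (int n + 1)" "real_of_int (int n - 1) < real_of_int m"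
    by (auto simp: abs_if split: if_splits)
  then have "m = int n" unfolding of_int_less_iff by simp
  then have u: "w - m = u" by (simp add: w_def u_def \<rho>_def)
  from small u show u8: "cmod u \<le> 1/8" by simp
  with nu u show "cmod u \<le> 48 * C / real n" by simp
  from low u u8 show "exp (pi * \<bar>Im (csqrt z)\<bar>) * cmod u / 8 \<le> cmod (osc j (csqrt z) pi)"
    by (simp add: \<rho>_def E_def)
qed

section \<open>Bessel inequality for shifted sines\<close>

lemma L2_pi_set_integrable:
  assumes "L2_pi f"
  shows "set_integrable lebesgue {0<..<pi} f"
proof -
  have "integrable (lebesgue_on {0<..<pi}) f"
  proof (rule Bochner_Integration.integrable_bound)
    have "finite_measure (lebesgue_on {0<..<pi})"
      by (rule finite_measure_lebesgue_on) simp
    then show "integrable (lebesgue_on {0<..<pi}) (\<lambda>t. 1 + (cmod (f t))\<^sup>2)"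
      using assms by (auto simp: L2_pi_def finite_measure.integrable_const)
    show "f \<in> borel_measurable (lebesgue_on {0<..<pi})"
      using assms by (simp add: L2_pi_def)
    have "x \<le> 1 + x\<^sup>2" for x :: real
      using zero_le_power2[of "x - 1 / 2"] by (simp add: power2_eq_square algebra_simps)
    then show "AE t in lebesgue_on {0<..<pi}. norm (f t) \<le> norm (1 + (cmod (f t))\<^sup>2)"
      by (intro AE_I2) simp
  qed
  then show ?thesis
    by (simp add: set_integrable_def integrable_restrict_space)
qed

text \<open>
  Integrate the square of the difference between \<open>u\<close> and its orthogonal projection onto the span
  of the \<open>e n\<close>.
\<close>
lemma Bessel_inequality:
  fixes u :: "'a \<Rightarrow> real" and e :: "'b \<Rightarrow> 'a \<Rightarrow> real"
  assumes u: "integrable M (\<lambda>t. (u t)\<^sup>2)"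
    and ue: "\<And>n. n \<in> I \<Longrightarrow> integrable M (\<lambda>t. u t * e n t)"
    and ee: "\<And>m n. m \<in> I \<Longrightarrow> n \<in> I \<Longrightarrow> integrable M (\<lambda>t. e m t * e n t)"
    and orth: "\<And>m n. m \<in> I \<Longrightarrow> n \<in> I \<Longrightarrow> (LINT t|M. e m t * e n t) = (if m = n then c else 0)"
    and c: "c > 0" and fin: "finite I"
  shows "(\<Sum>n\<in>I. (LINT t|M. u t * e n t)\<^sup>2) \<le> c * (LINT t|M. (u t)\<^sup>2)"
proof -
  define k where "k n = (LINT t|M. u t * e n t) / c" for n
  have ku: "(LINT t|M. u t * e n t) = c * k n" for n using c by (simp add: k_def)
  have "(u t - (\<Sum>n\<in>I. k n * e n t))\<^sup>2 =
      (u t)\<^sup>2 - 2 * (\<Sum>n\<in>I. k n * (u t * e n t)) + (\<Sum>m\<in>I. \<Sum>n\<in>I. k m * (k n * (e m t * e n t)))" for t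
    by (simp add: power2_diff power2_eq_square[of "sum _ _"] sum_product sum_distrib_left mult_ac)
  then have "(LINT t|M. (u t - (\<Sum>n\<in>I. k n * e n t))\<^sup>2) = (LINT t|M. (u t)\<^sup>2)
      - 2 * (\<Sum>n\<in>I. k n * (LINT t|M. u t * e n t))
      + (\<Sum>m\<in>I. \<Sum>n\<in>I. k m * (k n * (LINT t|M. e m t * e n t)))"
    using u ue ee by (simp add: Bochner_Integration.integral_sum)
  also have "(\<Sum>m\<in>I. \<Sum>n\<in>I. k m * (k n * (LINT t|M. e m t * e n t))) = c * (\<Sum>m\<in>I. (k m)\<^sup>2)"
    unfolding sum_distrib_left
  proof (rule sum.cong[OF refl])
    fix m assume m: "m \<in> I"
    have "(\<Sum>n\<in>I. k m * (k n * (LINT t|M. e m t * e n t))) = (\<Sum>n\<in>I. if m = n then k m * (k n * c) else 0)"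
      by (intro sum.cong refl) (simp add: orth m)
    then show "(\<Sum>n\<in>I. k m * (k n * (LINT t|M. e m t * e n t))) = c * (k m)\<^sup>2"
      using m fin by (simp add: power2_eq_square)
  qed
  also have "(\<Sum>n\<in>I. k n * (LINT t|M. u t * e n t)) = c * (\<Sum>n\<in>I. (k n)\<^sup>2)"
    by (simp add: ku sum_distrib_left power2_eq_square mult_ac)
  finally have "c * (\<Sum>n\<in>I. (k n)\<^sup>2) \<le> (LINT t|M. (u t)\<^sup>2)"
    using Bochner_Integration.integral_nonneg[of M "\<lambda>t. (u t - (\<Sum>n\<in>I. k n * e n t))\<^sup>2"] by simp
  then have "c * (c * (\<Sum>n\<in>I. (k n)\<^sup>2)) \<le> c * (LINT t|M. (u t)\<^sup>2)"
    using c by (intro mult_left_mono) auto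
  then show ?thesis
    by (simp add: ku power_mult_distrib sum_distrib_left power2_eq_square mult_ac)
qed

lemma cos_reflected_has_integral:
  fixes k :: int
  shows "((\<lambda>t. cos (k * (x - t))) has_integral (if k = 0 then pi else 0)) {x - pi..x}"
proof (cases "k = 0")
  case True
  then show ?thesis using has_integral_const_real[of "1 :: real" "x - pi" x] by simp
next
  case False
  have "((\<lambda>t. cos (k * (x - t))) has_integral
      (- sin (k * (x - x)) / k) - (- sin (k * (x - (x - pi))) / k)) {x - pi..x}"
    using False
    by (intro fundamental_theorem_of_calculus)
       (auto simp: has_real_derivative_iff_has_vector_derivative[symmetric] intro!: derivative_eq_intros)
  then show ?thesis using False by (simp add: sin_npi_int mult.commute)
qed

text \<open>
  By the product formula only \<open>cos (k (x - t))\<close> with integers \<open>k\<close> occur, and over an interval of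
  length \<open>pi\<close> ending at \<open>x\<close> their integrals vanish unless \<open>k = 0\<close>. This holds for integer and for
  half-integer frequencies alike.
\<close>
lemma sin_reflected_orthogonal:
  fixes m n :: nat and x :: real
  assumes j: "j \<in> {0, 1 :: nat}"
  defines "e \<equiv> \<lambda>n t. sin ((real (Suc n) - real j / 2) * (x - t))"
  shows "integrable (lebesgue_on {x - pi..x}) (\<lambda>t. e m t * e n t)"
    and "(LINT t|lebesgue_on {x - pi..x}. e m t * e n t) = (if m = n then pi / 2 else 0)"
proof -
  show i: "integrable (lebesgue_on {x - pi..x}) (\<lambda>t. e m t * e n t)"
    unfolding e_def by (intro continuous_imp_integrable_real continuous_intros)
  have eq: "e m t * e n t = (cos (real_of_int (int m - int n) * (x - t))
      - cos (real_of_int (int m + int n + 2 - int j) * (x - t))) / 2" for t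
    unfolding e_def sin_times_sin by (simp add: algebra_simps add_divide_distrib)
  have "((\<lambda>t. e m t * e n t) has_integral ((if int m - int n = 0 then pi else 0)
      - (if int m + int n + 2 - int j = 0 then pi else 0)) / 2) {x - pi..x}"
    unfolding eq by (intro has_integral_divide has_integral_diff cos_reflected_has_integral)
  also have "((if int m - int n = 0 then pi else 0)
      - (if int m + int n + 2 - int j = 0 then pi else 0)) / 2 = (if m = n then pi / 2 else 0)"
    using j by auto
  finally show "(LINT t|lebesgue_on {x - pi..x}. e m t * e n t) = (if m = n then pi / 2 else 0)"
    using lebesgue_integral_eq_integral[OF i] by (simp add: integral_unique)
qed

text \<open>
  The function \<open>f\<close>, cut off to \<open>(0, x)\<close>, lives on the interval \<open>[x - pi, x]\<close> where the shifted
  sines are orthogonal. Bessel's inequality is applied to its real and imaginary parts.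
\<close>
lemma sin_coefficients_square_summable:
  assumes f: "L2_pi f" and x: "0 \<le> x" "x \<le> pi" and j: "j \<in> {0, 1 :: nat}"
  shows "summable (\<lambda>n. (cmod (LINT t:{0<..<x}|lebesgue.
           of_real (sin ((real (Suc n) - real j / 2) * (x - t))) * f t))\<^sup>2)"
proof -
  define M where "M = lebesgue_on {x - pi..x}"
  define F where "F t = indicator {0<..<x} t *\<^sub>R f t" for t
  define e where "e n t = sin ((real (Suc n) - real j / 2) * (x - t))" for n t
  have sub: "indicat_real {x - pi..x} t *\<^sub>R F t = F t" for t
    using x by (auto simp: F_def indicator_def)
  have fi: "set_integrable lebesgue {0<..<x} f"
    by (rule set_integrable_subset[OF L2_pi_set_integrable[OF f]]) (use x in auto)
  have F: "integrable M F"
    using fi by (simp add: M_def integrable_restrict_space sub set_integrable_def F_def[symmetric])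
  have "set_integrable lebesgue {0<..<pi} (\<lambda>t. (cmod (f t))\<^sup>2)"
    using f by (simp add: L2_pi_def set_integrable_def integrable_restrict_space)
  then have "set_integrable lebesgue {0<..<x} (\<lambda>t. (cmod (f t))\<^sup>2)"
    by (rule set_integrable_subset) (use x in auto)
  moreover have "indicat_real {x - pi..x} t *\<^sub>R (cmod (F t))\<^sup>2 = indicat_real {0<..<x} t *\<^sub>R (cmod (f t))\<^sup>2" for t
    using x by (auto simp: F_def indicator_def)
  ultimately have F2: "integrable M (\<lambda>t. (cmod (F t))\<^sup>2)"
    by (simp add: M_def integrable_restrict_space set_integrable_def)
  have e_meas [measurable]: "e n \<in> borel_measurable M" for n
    unfolding e_def M_def
    by (intro continuous_imp_measurable_on_sets_lebesgue continuous_intros) auto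
  have F_meas [measurable]: "F \<in> borel_measurable M"
    using F by (rule borel_measurable_integrable)
  have e_le: "\<bar>e n t\<bar> \<le> 1" for n t by (simp add: e_def)
  have Fe: "integrable M (\<lambda>t. of_real (e n t) * F t)" for n
    by (rule Bochner_Integration.integrable_bound[OF F])
       (auto simp: norm_mult e_le intro!: AE_I2 mult_left_le_one_le)
  have coeff: "(LINT t:{0<..<x}|lebesgue. of_real (e n t) * f t) = (LINT t|M. of_real (e n t) * F t)" for n
    unfolding M_def set_lebesgue_integral_def
    by (subst integral_restrict_space) (use x in \<open>auto simp: F_def indicator_def intro!: Bochner_Integration.integral_cong\<close>)
  have Bessel: "(\<Sum>n<N. (LINT t|M. u t * e n t)\<^sup>2) \<le> pi / 2 * (LINT t|M. (cmod (F t))\<^sup>2)"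
    if m [measurable]: "u \<in> borel_measurable M" and le: "\<And>t. \<bar>u t\<bar> \<le> cmod (F t)" for u :: "real \<Rightarrow> real" and N
  proof -
    have u2: "integrable M (\<lambda>t. (u t)\<^sup>2)"
      by (rule Bochner_Integration.integrable_bound[OF F2])
         (auto intro!: AE_I2 abs_le_square_iff[THEN iffD1] le)
    have "(\<Sum>n<N. (LINT t|M. u t * e n t)\<^sup>2) \<le> pi / 2 * (LINT t|M. (u t)\<^sup>2)"
    proof (rule Bessel_inequality[OF u2])
      show "integrable M (\<lambda>t. u t * e n t)" for n
        by (rule Bochner_Integration.integrable_bound[OF F])
           (auto simp: abs_mult e_le intro!: AE_I2 order_trans[OF mult_right_le_one_le le])
    qed (use sin_reflected_orthogonal[OF j] in \<open>auto simp: M_def e_def\<close>)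
    also have "\<dots> \<le> pi / 2 * (LINT t|M. (cmod (F t))\<^sup>2)"
      by (intro mult_left_mono integral_mono u2 F2 abs_le_square_iff[THEN iffD1]) (auto simp: le)
    finally show ?thesis .
  qed
  have "(cmod (LINT t|M. of_real (e n t) * F t))\<^sup>2 = (LINT t|M. Re (F t) * e n t)\<^sup>2 + (LINT t|M. Im (F t) * e n t)\<^sup>2" for n
    using integral_Re[OF Fe[of n]] integral_Im[OF Fe[of n]] by (simp add: cmod_power2 mult_ac)
  then have "(\<Sum>n<N. (cmod (LINT t|M. of_real (e n t) * F t))\<^sup>2)
      \<le> pi / 2 * (LINT t|M. (cmod (F t))\<^sup>2) + pi / 2 * (LINT t|M. (cmod (F t))\<^sup>2)" for N
    using Bessel[of "\<lambda>t. Re (F t)" N] Bessel[of "\<lambda>t. Im (F t)" N] F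
    by (simp add: sum.distrib abs_Re_le_cmod abs_Im_le_cmod)
  then show ?thesis
    unfolding e_def[symmetric] coeff by (intro summableI_nonneg_bounded) auto
qed

section \<open>Square-summable remainders\<close>

lemma summable_square_add:
  fixes g h :: "nat \<Rightarrow> real"
  assumes "summable (\<lambda>n. (g n)\<^sup>2)" "summable (\<lambda>n. (h n)\<^sup>2)"
  shows "summable (\<lambda>n. (g n + h n)\<^sup>2)"
proof (rule summable_comparison_test')
  show "summable (\<lambda>n. 2 * (g n)\<^sup>2 + 2 * (h n)\<^sup>2)"
    by (intro summable_add summable_mult assms)
  have "(g n + h n)\<^sup>2 \<le> 2 * (g n)\<^sup>2 + 2 * (h n)\<^sup>2" for n
    using zero_le_power2[of "g n - h n"] by (simp add: power2_diff power2_sum)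
  then show "norm ((g n + h n)\<^sup>2) \<le> 2 * (g n)\<^sup>2 + 2 * (h n)\<^sup>2" for n
    by (simp only: real_norm_def abs_of_nonneg zero_le_power2)
qed

text \<open>
  At the grid points these are the coefficients of \<open>sin_coefficients_square_summable\<close>; moving the
  frequency by \<open>O(1/n)\<close> inside the strip \<open>\<bar>Im \<rho>\<bar> \<le> 1\<close> changes the integrals by \<open>O(1/n)\<close>.
\<close>
lemma sin_conv_scaled_square_summable:
  assumes f: "L2_pi f" and x: "0 \<le> x" "x \<le> pi" and j: "j \<in> {0, 1 :: nat}"
    and near: "\<And>n. n \<ge> n0 \<Longrightarrow> cmod (\<rho> n - of_real (real n - real j / 2)) \<le> K / real n"
    and Im: "\<And>n. n \<ge> n0 \<Longrightarrow> \<bar>Im (\<rho> n)\<bar> \<le> 1"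
  shows "summable (\<lambda>n. (cmod (\<rho> n * sin_conv f (\<rho> n) x))\<^sup>2)"
proof -
  define \<mu> where "\<mu> n = real n - real j / 2" for n
  define c where "c n = (LINT t:{0<..<x}|lebesgue. of_real (sin (\<mu> n * (x - t))) * f t)" for n
  define L where "L = (LINT t:{0<..<x}|lebesgue. cmod (f t))"
  have fi: "set_integrable lebesgue {0<..<x} f"
    by (rule set_integrable_subset[OF L2_pi_set_integrable[OF f]]) (use x in auto)
  have m: "(\<lambda>t. sin (r * complex_of_real (x - t))) \<in> borel_measurable borel" for r
    by (intro borel_measurable_continuous_onI continuous_intros)
  have im: "\<bar>Im (r * of_real s)\<bar> \<le> pi" if "\<bar>Im r\<bar> \<le> 1" "\<bar>s\<bar> \<le> pi" for r s
    using mult_mono[OF that] by (simp add: abs_mult)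
  have int: "set_integrable lebesgue {0<..<x} (\<lambda>t. sin (r * of_real (x - t)) * f t)" if "\<bar>Im r\<bar> \<le> 1" for r
  proof (rule set_integrable_mult_bounded[OF fi m])
    fix t assume "t \<in> {0<..<x}"
    then have "\<bar>Im (r * of_real (x - t))\<bar> \<le> pi" using that x by (intro im) auto
    then show "cmod (sin (r * of_real (x - t))) \<le> exp pi"
      using norm_sin_le_exp_Im by (meson exp_le_cancel_iff order_trans)
  qed
  have bound: "cmod (\<rho> n * sin_conv f (\<rho> n) x) \<le> cmod (c n) + exp pi * pi * L * K * inverse (real n)"
    if n: "n \<ge> n0" for n
  proof -
    have c: "c n = (LINT t:{0<..<x}|lebesgue. sin (of_real (\<mu> n) * of_real (x - t)) * f t)"
      by (simp add: c_def flip: sin_of_real)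
    have "\<rho> n * sin_conv f (\<rho> n) x - c n = (LINT t:{0<..<x}|lebesgue.
        (sin (\<rho> n * of_real (x - t)) - sin (of_real (\<mu> n) * of_real (x - t))) * f t)"
      unfolding c sin_conv_scaled using int[of "\<rho> n"] int[of "of_real (\<mu> n)"] Im[OF n]
      by (subst set_integral_diff(2)[symmetric]) (simp_all add: left_diff_distrib)
    also have "cmod \<dots> \<le> (exp pi * (pi * (K / real n))) * L"
      unfolding L_def
    proof (rule norm_set_integral_mult_le[OF fi])
      show "(\<lambda>t. sin (\<rho> n * of_real (x - t)) - sin (of_real (\<mu> n) * complex_of_real (x - t))) \<in> borel_measurable borel"
        by (intro borel_measurable_diff m)
      fix t assume t: "t \<in> {0<..<x}"
      have "cmod (sin (\<rho> n * of_real (x - t)) - sin (of_real (\<mu> n) * of_real (x - t)))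
          \<le> exp pi * cmod (\<rho> n * of_real (x - t) - of_real (\<mu> n) * of_real (x - t))"
        using t x Im[OF n] by (intro norm_sin_diff_le im) auto
      also have "cmod (\<rho> n * of_real (x - t) - of_real (\<mu> n) * of_real (x - t)) = \<bar>x - t\<bar> * cmod (\<rho> n - of_real (\<mu> n))"
        by (metis left_diff_distrib norm_mult norm_of_real mult.commute)
      also have "exp pi * \<dots> \<le> exp pi * (pi * (K / real n))"
        using t x near[OF n] by (intro mult_left_mono mult_mono) (auto simp: \<mu>_def)
      finally show "cmod (sin (\<rho> n * of_real (x - t)) - sin (of_real (\<mu> n) * of_real (x - t)))
          \<le> exp pi * (pi * (K / real n))" .
    qed
    finally have "cmod (\<rho> n * sin_conv f (\<rho> n) x - c n) \<le> exp pi * pi * L * K * inverse (real n)"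
      by (simp add: field_simps)
    then show ?thesis
      using norm_triangle_sub[of "\<rho> n * sin_conv f (\<rho> n) x" "c n"] by linarith
  qed
  have "summable (\<lambda>n. (cmod (c (Suc n)))\<^sup>2)"
    using sin_coefficients_square_summable[OF f x j] by (simp add: c_def \<mu>_def)
  then have "summable (\<lambda>n. (cmod (c n))\<^sup>2)" by (subst (asm) summable_Suc_iff)
  moreover have "summable (\<lambda>n. (exp pi * pi * L * K * inverse (real n))\<^sup>2)"
    unfolding power_mult_distrib power_inverse
    by (intro summable_mult inverse_power_summable) simp
  ultimately have "summable (\<lambda>n. (cmod (c n) + exp pi * pi * L * K * inverse (real n))\<^sup>2)"
    by (rule summable_square_add)
  then show ?thesis
    by (rule summable_comparison_test_ev[rotated])
       (auto intro!: eventually_sequentiallyI[of n0] power_mono bound)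
qed

text \<open>
  Passage from the shift \<open>u\<close> of the root to the shift of the eigenvalue: the factor
  \<open>\<rho> + \<mu>\<close> costs one power of \<open>\<bar>\<rho>\<bar>\<close>, which \<open>k\<close> gives back when it bounds the minors.
\<close>
lemma norm_square_shift_le:
  assumes u: "cmod u \<le> 1" and \<rho>: "cmod \<rho> \<ge> 1" and s: "cmod u / 8 \<le> cmod (osc j \<rho> pi)"
    and k: "cmod (osc j \<rho> pi) \<le> 3 * k" and mu: "\<rho> = of_real \<mu> + u"
  shows "cmod (\<rho>\<^sup>2 - of_real (\<mu>\<^sup>2)) \<le> 72 * (cmod \<rho> * k)"
proof -
  have "\<rho>\<^sup>2 - of_real (\<mu>\<^sup>2) = u * (2 * \<rho> - u)"
    by (simp add: mu power2_eq_square algebra_simps)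
  also have "cmod \<dots> \<le> (24 * k) * (3 * cmod \<rho>)"
    unfolding norm_mult
  proof (rule mult_mono)
    show "cmod (2 * \<rho> - u) \<le> 3 * cmod \<rho>"
      using u \<rho> norm_triangle_ineq4[of "2 * \<rho>" u] by (simp add: norm_mult)
  qed (use s k order_trans[OF norm_ge_zero k] in auto)
  finally show ?thesis by (simp add: mult_ac)
qed

text \<open>
  Near the real axis all oscillating factors are bounded, so no cancellation has to be used.
  Unlike \<open>norm_minor_le\<close> this keeps the integrals on the right, whose decay matters now.
\<close>
lemma norm_minor_le_scaled:
  assumes x: "0 \<le> x" "x \<le> pi" and Im: "\<bar>Im \<rho>\<bar> \<le> 1"
  shows "cmod \<rho> * cmod (minor j f \<rho> x) \<le> exp pi * (cmod (\<rho> * sin_conv f \<rho> pi) + cmod (\<rho> * sin_conv f \<rho> x))"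
proof -
  have o: "cmod (osc j \<rho> y) \<le> exp pi" if "0 \<le> y" "y \<le> pi" for y
  proof -
    have "\<bar>Im \<rho>\<bar> * y \<le> 1 * pi" using Im that by (intro mult_mono) auto
    then have "exp (\<bar>Im \<rho>\<bar> * y) \<le> exp pi" by simp
    with norm_osc_le[OF that(1)] show ?thesis by (rule order_trans)
  qed
  have "\<rho> * minor j f \<rho> x = osc j \<rho> x * (\<rho> * sin_conv f \<rho> pi) - osc j \<rho> pi * (\<rho> * sin_conv f \<rho> x)"
    by (simp add: minor_def algebra_simps)
  then have "cmod \<rho> * cmod (minor j f \<rho> x) =
      cmod (osc j \<rho> x * (\<rho> * sin_conv f \<rho> pi) - osc j \<rho> pi * (\<rho> * sin_conv f \<rho> x))"
    by (simp only: norm_mult[of \<rho>, symmetric])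
  also have "\<dots> \<le> exp pi * cmod (\<rho> * sin_conv f \<rho> pi) + exp pi * cmod (\<rho> * sin_conv f \<rho> x)"
  proof (rule norm_triangle_le_diff, rule add_mono)
    show "cmod (osc j \<rho> x * (\<rho> * sin_conv f \<rho> pi)) \<le> exp pi * cmod (\<rho> * sin_conv f \<rho> pi)"
      unfolding norm_mult[of "osc j \<rho> x"] by (intro mult_right_mono o x norm_ge_zero)
    show "cmod (osc j \<rho> pi * (\<rho> * sin_conv f \<rho> x)) \<le> exp pi * cmod (\<rho> * sin_conv f \<rho> x)"
      unfolding norm_mult[of "osc j \<rho> pi"] by (intro mult_right_mono o pi_ge_zero order_refl norm_ge_zero)
  qed
  finally show ?thesis by (simp add: distrib_left)
qed

theorem theorem2p1:
  fixes a b :: real and p q :: "real \<Rightarrow> complex" and j :: nat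
  assumes "0 < a" and "a < b" and "b < pi"
    and "L2_pi p" and "L2_pi q"
    and "j \<in> {0, 1}"
  shows "(\<exists>ev. is_spectrum a b p q j ev) \<and>
    (\<forall>ev. is_spectrum a b p q j ev \<longrightarrow>
      (\<exists>\<kappa> :: nat \<Rightarrow> complex.
        (\<forall>n\<ge>1. ev n = of_real ((real n - real j / 2)\<^sup>2) + \<kappa> n) \<and>
        (\<lambda>n. (cmod (\<kappa> n))\<^sup>2) summable_on {1..}))"
proof -
  note j = \<open>j \<in> {0, 1}\<close>
  have p: "set_integrable lebesgue {0<..<pi} p" and q: "set_integrable lebesgue {0<..<pi} q"
    using L2_pi_set_integrable[OF \<open>L2_pi p\<close>] L2_pi_set_integrable[OF \<open>L2_pi q\<close>] .
  have ab: "0 \<le> a" "a \<le> pi" "0 \<le> b" "b \<le> pi" using assms by auto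
  define D where "D = char_fun a b p q j"
  define C where "C = max (LINT t:{0<..<pi}|lebesgue. cmod (p t)) (LINT t:{0<..<pi}|lebesgue. cmod (q t))"
  have C: "(LINT t:{0<..<pi}|lebesgue. cmod (p t)) \<le> C" "(LINT t:{0<..<pi}|lebesgue. cmod (q t)) \<le> C"
    by (simp_all add: C_def)
  have spectrum_iff: "is_spectrum a b p q j ev \<longleftrightarrow> lists_zeros D ev" for ev
    by (simp add: is_spectrum_def lists_zeros_def D_def)
  obtain N0 :: nat where N0: "N0 \<ge> 2" "384 * C < real N0"
  proof -
    obtain N :: nat where "384 * C < real N" using reals_Archimedean2 by blast
    then show ?thesis using that[of "max 2 N"] by (simp add: less_max_iff_disj)
  qed
  have C0: "0 \<le> C" unfolding C_def set_lebesgue_integral_def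
    by (intro max.coboundedI1 Bochner_Integration.integral_nonneg) simp
  have holo: "D holomorphic_on UNIV"
    unfolding D_def by (rule char_fun_holomorphic[OF p q ab])
  have count: "(\<Sum>z | cmod z < (real N + 1/2 - real j / 2)\<^sup>2 \<and> D z = 0. zorder D z) = int N"
    and nz: "D (of_real ((real N + 1/2 - real j / 2)\<^sup>2)) \<noteq> 0" if "N \<ge> N0" for N
    using sum_zorder_char_fun[OF p q ab j C, of N] that N0 C0 by (auto simp: D_def simp del: of_real_power)
  show ?thesis
    unfolding spectrum_iff
  proof (intro conjI allI impI)
    show "\<exists>ev. lists_zeros D ev"
      by (rule lists_zeros_exists[OF holo nz[OF order_refl] count])
  next
    fix ev assume ev: "lists_zeros D ev"
    define \<rho> where "\<rho> n = csqrt (ev n)" for n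
    define \<mu> where "\<mu> n = real n - real j / 2" for n
    define u where "u n = \<rho> n - of_real (\<mu> n)" for n
    define \<kappa> where "\<kappa> n = ev n - of_real ((\<mu> n)\<^sup>2)" for n
    \<comment> \<open>With \<open>N = n\<close> and \<open>N = n - 1\<close> this places \<open>ev n\<close> between two consecutive circles.\<close>
    have disc: "cmod (ev n) < (real N + 1/2 - real j / 2)\<^sup>2 \<longleftrightarrow> n \<le> N" if "n \<ge> 1" "N \<ge> N0" for n N
      using lists_zeros_disc[OF ev holo nz[OF that(2)] count[OF that(2)] that(1)] .
    have loc: "cmod (\<rho> n) \<ge> real n - 1/2 - real j / 2"
       "cmod (u n) \<le> 48 * C / real n" "cmod (u n) \<le> 1/8"
       "exp (pi * \<bar>Im (\<rho> n)\<bar>) * cmod (u n) / 8 \<le> cmod (osc j (\<rho> n) pi)"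
       "D (ev n) = 0" if n: "n > N0" for n
    proof -
      show D0: "D (ev n) = 0" using ev n by (auto simp: lists_zeros_def)
      have sq: "(cmod (\<rho> n))\<^sup>2 = cmod (ev n)"
        by (simp add: \<rho>_def flip: norm_power)
      have "real (n - 1) + 1/2 - real j / 2 = real n - 1/2 - real j / 2" using n by simp
      moreover have "N0 \<le> n - 1" "\<not> n \<le> n - 1" "1 \<le> n" using n by linarith+
      ultimately have "(real n - 1/2 - real j / 2)\<^sup>2 \<le> (cmod (\<rho> n))\<^sup>2"
        using disc[of n "n - 1"] by (simp add: sq not_less)
      then show lower: "cmod (\<rho> n) \<ge> real n - 1/2 - real j / 2"
        by (rule power2_le_imp_le) simp
      have upper: "cmod (\<rho> n) < real n + 1/2 - real j / 2"
      proof (rule power2_less_imp_less)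
        show "(cmod (\<rho> n))\<^sup>2 < (real n + 1/2 - real j / 2)\<^sup>2"
          unfolding sq using disc[of n n] n by simp
        show "0 \<le> real n + 1/2 - real j / 2" using j by auto
      qed
      show "cmod (u n) \<le> 48 * C / real n" "cmod (u n) \<le> 1/8"
        "exp (pi * \<bar>Im (\<rho> n)\<bar>) * cmod (u n) / 8 \<le> cmod (osc j (\<rho> n) pi)"
        unfolding u_def \<rho>_def \<mu>_def
        by (rule zero_near_grid[OF p q ab j C _ _ D0[unfolded D_def] lower[unfolded \<rho>_def] upper[unfolded \<rho>_def]];
            use N0 n in simp)+
    qed
    have Im: "\<bar>Im (\<rho> n)\<bar> \<le> 1" if "n > N0" for n
      using abs_Im_le_cmod[of "u n"] loc(3)[OF that] by (simp add: u_def)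
    define T where "T f x n = cmod (\<rho> n * sin_conv f (\<rho> n) x)" for f x n
    have T: "summable (\<lambda>n. (T f x n)\<^sup>2)" if "f \<in> {p, q}" "x \<in> {a, b, pi}" for f x
      unfolding T_def
      by (rule sin_conv_scaled_square_summable[OF _ _ _ j, of _ _ "Suc N0" _ "48 * C"])
         (use that assms loc(2) Im in \<open>auto simp: u_def \<mu>_def\<close>)
    \<comment> \<open>The terms that \<open>norm_minor_le_scaled\<close> produces for the four minors in the condensed determinant.\<close>
    define B where "B n = (T p pi n + T p a n) + (T p pi n + T p b n) + (T q pi n + T q a n) + (T q pi n + T q b n)" for n
    have B: "summable (\<lambda>n. (B n)\<^sup>2)"
      unfolding B_def by (intro summable_square_add T) auto
    have \<kappa>_le: "cmod (\<kappa> n) \<le> 72 * exp pi * B n" if n: "n > N0" for n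
    proof -
      \<comment> \<open>A common bound for the four minors at the zero; it is square-summable after multiplication by \<open>\<bar>\<rho> n\<bar>\<close>.\<close>
      define k where "k = exp pi * B n / cmod (\<rho> n)"
      have \<rho>1: "cmod (\<rho> n) \<ge> 1" using loc(1)[OF n] n N0 j by auto
      have T0: "T f x n \<ge> 0" for f x by (simp add: T_def)
      have k: "cmod (minor j f (\<rho> n) x) \<le> k" if "x \<in> {a, b}" "f \<in> {p, q}" for f x
      proof -
        have "cmod (\<rho> n) * cmod (minor j f (\<rho> n) x) \<le> exp pi * (T f pi n + T f x n)"
          unfolding T_def by (rule norm_minor_le_scaled) (use that ab Im[OF n] in auto)
        also have "\<dots> \<le> exp pi * B n"
          using that T0[of p pi] T0[of p a] T0[of p b] T0[of q pi] T0[of q a] T0[of q b]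
          by (intro mult_left_mono) (auto simp: B_def)
        finally have "cmod (minor j f (\<rho> n) x) * cmod (\<rho> n) \<le> exp pi * B n"
          by (simp only: mult.commute)
        moreover have "cmod (\<rho> n) > 0" using \<rho>1 by linarith
        ultimately show ?thesis unfolding k_def by (simp only: pos_le_divide_eq)
      qed
      have "cmod (osc j (\<rho> n) pi) \<le> 3 * k"
      proof (rule ccontr)
        assume "\<not> ?thesis"
        then have large: "3 * k < cmod (osc j (\<rho> n) pi)" by (simp only: not_le)
        have "cmod (D (ev n) - phi j (\<rho> n) pi) < cmod (phi j (\<rho> n) pi)"
          unfolding D_def char_fun_def \<rho>_def[symmetric]
          by (rule det_char_matrix_near_phi[OF k k k k large]) simp_all
        with loc(5)[OF n] show False by simp
      qed
      moreover have "1 * cmod (u n) / 8 \<le> exp (pi * \<bar>Im (\<rho> n)\<bar>) * cmod (u n) / 8"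
        by (intro divide_right_mono mult_right_mono) auto
      ultimately have "cmod ((\<rho> n)\<^sup>2 - of_real ((\<mu> n)\<^sup>2)) \<le> 72 * (cmod (\<rho> n) * k)"
        using loc(3,4)[OF n] \<rho>1 by (intro norm_square_shift_le[of "u n"]) (auto simp: u_def)
      also have "cmod (\<rho> n) * k = exp pi * B n" using \<rho>1 by (auto simp: k_def)
      also have "(\<rho> n)\<^sup>2 = ev n" by (simp add: \<rho>_def)
      finally show ?thesis by (simp add: \<kappa>_def)
    qed
    have "summable (\<lambda>n. (72 * exp pi * B n)\<^sup>2)"
      unfolding power_mult_distrib[of "72 * exp pi"] by (intro summable_mult B)
    then have "summable (\<lambda>n. (cmod (\<kappa> n))\<^sup>2)"
      by (rule summable_comparison_test_ev[rotated])
         (auto intro!: eventually_sequentiallyI[of "Suc N0"] power_mono \<kappa>_le)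
    then have "(\<lambda>n. (cmod (\<kappa> n))\<^sup>2) summable_on UNIV"
      by (intro norm_summable_imp_summable_on) simp
    then have "(\<lambda>n. (cmod (\<kappa> n))\<^sup>2) summable_on {1..}"
      by (rule summable_on_subset_banach) simp
    then show "\<exists>\<kappa>. (\<forall>n\<ge>1. ev n = of_real ((real n - real j / 2)\<^sup>2) + \<kappa> n) \<and>
        (\<lambda>n. (cmod (\<kappa> n))\<^sup>2) summable_on {1..}"
      by (intro exI[of _ \<kappa>]) (simp add: \<kappa>_def \<mu>_def)
  qed
qed

end
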